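(* Let $G(N)$ denote the number of partitions $\pi$ of $N$ into distinct parts such that no gap (difference) between consecutive parts of $\pi$ is $\equiv 1\pmod 4$, and such that for each $k$, the $k$-th smallest part $b$ of $\pi$ satisfies $$b\equiv 1+2k+2s(b;\pi)\pmod 4\ \text{ if } b \text{ is odd},\qquad b\equiv 2+2k+2s(b;\pi)\pmod 4\ \text{ if } b\text{ is even}.$$ Let $P(N)$ denote the number of partitions of $N$ into parts $\equiv \pm 3,\pm 4\pmod{12}$ such that parts $\equiv 3\pmod 6$ are distinct (not repeated). Then, for every nonnegative integer $N$, $$G(N)=P(N).$$
   Context: For a part $b$ of a partition $\pi$, $s(b;\pi)$ is the number of even parts of $\pi$ that are less than $b$. The empty partition is the unique partition of $0$. *)

theory Defs
  imports Main "HOL-Library.Multiset" "HOL-Number_Theory.Cong"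
begin

definition partitions_of :: "nat \<Rightarrow> nat multiset set" where
  "partitions_of N = {p. (\<forall>b \<in># p. b > 0) \<and> sum_mset p = N}"

definition distinct_parts :: "nat multiset \<Rightarrow> bool" where
  "distinct_parts p \<longleftrightarrow> (\<forall>b \<in># p. count p b = 1)"

text \<open>The smallest part has index \<open>k = 1\<close>; only indices with
  \<open>1 \<le> k \<le> size p\<close> are meaningful.\<close>

definition kth_smallest :: "nat multiset \<Rightarrow> nat \<Rightarrow> nat" where
  "kth_smallest p k = sorted_list_of_multiset p ! (k - 1)"

definition even_parts_below :: "nat \<Rightarrow> nat multiset \<Rightarrow> nat" where
  "even_parts_below b p = size {#a \<in># p. even a \<and> a < b#}"

text \<open>Gaps are differences of two parts of the partition, so the smallest part itself is not
  counted as a gap. The subtraction does not truncate, because the parts are listed in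
  increasing order.\<close>

definition G_partitions :: "nat \<Rightarrow> nat multiset set" where
  "G_partitions N = {p \<in> partitions_of N.
     distinct_parts p \<and>
     (\<forall>k \<in> {1..<size p}. \<not> [kth_smallest p (k + 1) - kth_smallest p k = 1] (mod 4)) \<and>
     (\<forall>k \<in> {1..size p}. let b = kth_smallest p k in
        (odd b \<longrightarrow> [b = 1 + 2 * k + 2 * even_parts_below b p] (mod 4)) \<and>
        (even b \<longrightarrow> [b = 2 + 2 * k + 2 * even_parts_below b p] (mod 4)))}"

definition count_G :: "nat \<Rightarrow> nat" where
  "count_G N = card (G_partitions N)"

definition P_partitions :: "nat \<Rightarrow> nat multiset set" where
  "P_partitions N = {p \<in> partitions_of N.
     (\<forall>b \<in># p. [int b = 3] (mod 12) \<or> [int b = -3] (mod 12) \<or>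
              [int b = 4] (mod 12) \<or> [int b = -4] (mod 12)) \<and>
     (\<forall>b \<in># p. [b = 3] (mod 6) \<longrightarrow> count p b = 1)}"

definition count_P :: "nat \<Rightarrow> nat" where
  "count_P N = card (P_partitions N)"

lemma finite_partitions_of: "finite (partitions_of N)"
proof (rule finite_subset)
  show "partitions_of N \<subseteq> mset ` {xs. set xs \<subseteq> {..N} \<and> length xs \<le> N}"
  proof
    fix p assume p: "p \<in> partitions_of N"
    obtain xs where xs: "p = mset xs" by (metis ex_mset)
    have pos: "\<forall>b \<in> set xs. b > 0" and sm: "sum_list xs = N"
      using p by (auto simp: partitions_of_def xs sum_mset_sum_list)
    have "length xs \<le> sum_list xs" using pos by (induction xs) auto
    moreover have "set xs \<subseteq> {..N}" using sm member_le_sum_list by auto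
    ultimately show "p \<in> mset ` {xs. set xs \<subseteq> {..N} \<and> length xs \<le> N}"
      using xs sm by auto
  qed
  show "finite (mset ` {xs. set xs \<subseteq> {..N} \<and> length xs \<le> N})"
    by (intro finite_imageI finite_lists_length_le) simp
qed

lemma finite_G_partitions: "finite (G_partitions N)"
  and finite_P_partitions: "finite (P_partitions N)"
  using finite_partitions_of[of N] by (auto simp: G_partitions_def P_partitions_def)

end

theory Submission
  imports Defs "HOL-Computational_Algebra.Formal_Power_Series"
begin

text \<open>The conditions on \<open>\<pi>\<close> only constrain consecutive parts: from an even (odd) part to an even
  (odd) part the gap is 4 (2) plus a multiple of 4, and a change of parity costs 3 plus a multiple
  of 4. Classifying by the smallest part (3, 4, or larger), the partitions with \<open>n\<close> parts have
  generating function \<open>q^(n^2 + 2n) (-q; q^2)_n / (q^4; q^4)_n\<close>. It remains to show the Slater-type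
  identity
  \<open>(\<Sum>n. q^(n^2 + 2n) (-q; q^2)_n / (q^4; q^4)_n) = (-q^3; q^6)_\<infinity> / ((q^4; q^12)_\<infinity> (q^8; q^12)_\<infinity>)\<close>.
  Put \<open>Q = q^2\<close>. Bailey's lemma with \<open>a = Q\<close>, \<open>\<rho>\<^sub>2 \<rightarrow> \<infinity>\<close> rests on the \<open>q\<close>-Chu-Vandermonde sum alone. Applied to the
  unit Bailey pair with \<open>\<rho>\<^sub>1 = -Q\<close> it gives a pair with \<open>\<beta>\<^sub>n = 1 / (Q^2; Q^2)_n\<close>; applied once more with
  \<open>\<rho>\<^sub>1 = -q\<close> it turns the left-hand side into a product times
  \<open>\<Sum>r. (-1)^r q^(3r^2 + 2r) (1 - q^(2r + 1))\<close>, which the Jacobi triple product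
  evaluates. All identities are proved in finite form and then compared coefficientwise.\<close>

section \<open>The \<open>q\<close>-Chu-Vandermonde sum\<close>

text \<open>The finite q-shifted factorial (x; Q)_n. The base is an argument because the bases q^2,
  q^4, q^6 and q^12 all occur below.\<close>

definition qpoch :: "'a::comm_ring_1 \<Rightarrow> 'a \<Rightarrow> nat \<Rightarrow> 'a" where
  "qpoch x Q n = (\<Prod>i<n. 1 - x * Q ^ i)"

lemma qpoch_0 [simp]: "qpoch x Q 0 = 1"
  by (simp add: qpoch_def)

lemma qpoch_Suc: "qpoch x Q (Suc n) = qpoch x Q n * (1 - x * Q ^ n)"
  by (simp add: qpoch_def)

lemma qpoch_Suc_left: "qpoch x Q (Suc n) = (1 - x) * qpoch (x * Q) Q n"
  by (simp add: qpoch_def prod.lessThan_Suc_shift mult.assoc del: prod.lessThan_Suc)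

lemma qpoch_add: "qpoch x Q (m + n) = qpoch x Q m * qpoch (x * Q ^ m) Q n"
  by (induction n) (simp_all add: qpoch_Suc power_add mult.assoc)

text \<open>Gaussian binomial coefficients, given by one of their Pascal rules so that they exist in
  every commutative ring without division.\<close>

fun qbin :: "'a::comm_ring_1 \<Rightarrow> nat \<Rightarrow> nat \<Rightarrow> 'a" where
  "qbin Q n 0 = 1"
| "qbin Q 0 (Suc k) = 0"
| "qbin Q (Suc n) (Suc k) = qbin Q n (Suc k) + Q ^ (n - k) * qbin Q n k"

lemma qbin_eq_0: "n < k \<Longrightarrow> qbin Q n k = 0"
  by (induction Q n k rule: qbin.induct) auto

lemma qbin_self [simp]: "qbin Q n n = 1"
  by (induction n) (simp_all add: qbin_eq_0)

text \<open>The quotient formula for Gaussian binomials with denominators cleared. The Pascal rule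
  reduces it to 1 - Q^(a+b) = (1 - Q^b) + Q^b (1 - Q^a).\<close>

lemma qbin_mult_qpoch:
  "qbin Q (a + b) a * (qpoch Q Q a * qpoch Q Q b) = qpoch Q Q (a + b)"
proof (induction "a + b" arbitrary: a b)
  case 0
  then show ?case by simp
next
  case (Suc n)
  show ?case
  proof (cases a)
    case 0
    then show ?thesis by simp
  next
    case a: (Suc a')
    show ?thesis
    proof (cases b)
      case 0
      then show ?thesis by simp
    next
      case b: (Suc b')
      have n: "a + b' = n" "a' + b = n" using Suc.hyps(2) a b by auto
      have IH1: "qbin Q n a * (qpoch Q Q a * qpoch Q Q b') = qpoch Q Q n"
        using Suc.hyps(1)[of a b'] n by simp
      have IH2: "qbin Q n a' * (qpoch Q Q a' * qpoch Q Q b) = qpoch Q Q n"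
        using Suc.hyps(1)[of a' b] n by simp
      have nb: "n - a' = b" using n by simp
      have rec: "qbin Q (a + b) a = qbin Q n a + Q ^ b * qbin Q n a'"
        using Suc.hyps(2) by (metis a nb qbin.simps(3))
      have pb: "qpoch Q Q b = qpoch Q Q b' * (1 - Q ^ b)"
        by (simp add: b qpoch_Suc)
      have pa: "qpoch Q Q a = qpoch Q Q a' * (1 - Q ^ a)"
        by (simp add: a qpoch_Suc)
      have "qbin Q (a + b) a * (qpoch Q Q a * qpoch Q Q b)
          = (qbin Q n a * (qpoch Q Q a * qpoch Q Q b')) * (1 - Q ^ b)
            + Q ^ b * (1 - Q ^ a) * (qbin Q n a' * (qpoch Q Q a' * qpoch Q Q b))"
        unfolding rec pa pb by (simp add: algebra_simps)
      also have "\<dots> = qpoch Q Q n * (1 - Q ^ (a + b))"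
        unfolding IH1 IH2 by (simp add: algebra_simps power_add)
      also have "\<dots> = qpoch Q Q (a + b)"
        using Suc.hyps(2) by (metis power_Suc qpoch_Suc)
      finally show ?thesis .
    qed
  qed
qed

lemma Suc_choose_two: "Suc m choose 2 = (m choose 2) + m"
  by (simp add: numeral_2_eq_2)

lemma add_choose_two: "(m + n) choose 2 = (m choose 2) + (n choose 2) + m * n"
  by (induction n) (simp_all add: Suc_choose_two binomial_eq_0)

text \<open>Induction on \<open>M\<close> with \<open>b\<close> free. The Pascal rule splits the sum
  in two: one part is the sum for \<open>b\<close> times 1 - b e Q^M, the other is the sum for
  \<open>b * Q\<close> times -e Q^M (1 - b). Both sums equal (e; Q)_M by induction, and the two
  coefficients add up to 1 - e Q^M.\<close>

lemma q_chu_vandermonde: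
  "(\<Sum>m\<le>M. qbin Q M m * qpoch b Q m * qpoch (b * e * Q ^ m) Q (M - m) * (- e) ^ m * Q ^ (m choose 2))
    = qpoch e Q M"
proof (induction M arbitrary: b)
  case 0
  show ?case by (simp add: binomial_eq_0)
next
  case (Suc M)
  let ?t = "\<lambda>b M m. qpoch b Q m * qpoch (b * e * Q ^ m) Q (M - m) * (- e) ^ m * Q ^ (m choose 2)"
  have low: "?t b (Suc M) m = (1 - b * e * Q ^ M) * ?t b M m" if "m \<le> M" for m
    using that by (simp add: Suc_diff_le qpoch_Suc mult.assoc flip: power_add)
  have high: "Q ^ (M - m) * ?t b (Suc M) (Suc m) = - e * Q ^ M * (1 - b) * ?t (b * Q) M m"
    if "m \<le> M" for m
  proof -
    have "Q ^ M = Q ^ (M - m) * Q ^ m"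
      using that by (simp flip: power_add)
    then show ?thesis
      by (simp add: Suc_choose_two qpoch_Suc_left power_add mult_ac)
  qed
  have "(\<Sum>m\<le>Suc M. qbin Q (Suc M) m * ?t b (Suc M) m)
      = ?t b (Suc M) 0 + (\<Sum>m\<le>M. qbin Q (Suc M) (Suc m) * ?t b (Suc M) (Suc m))"
    by (simp add: sum.atMost_Suc_shift binomial_eq_0 del: sum.atMost_Suc qbin.simps(3))
  also have "\<dots> = (?t b (Suc M) 0 + (\<Sum>m\<le>M. qbin Q M (Suc m) * ?t b (Suc M) (Suc m)))
      + (\<Sum>m\<le>M. Q ^ (M - m) * qbin Q M m * ?t b (Suc M) (Suc m))"
    by (simp only: qbin.simps(3) distrib_right sum.distrib add.assoc)
  also have "?t b (Suc M) 0 + (\<Sum>m\<le>M. qbin Q M (Suc m) * ?t b (Suc M) (Suc m))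
      = (\<Sum>m\<le>Suc M. qbin Q M m * ?t b (Suc M) m)"
    by (simp add: sum.atMost_Suc_shift del: sum.atMost_Suc)
  also have "\<dots> = (\<Sum>m\<le>M. qbin Q M m * ?t b (Suc M) m)"
    by (simp add: qbin_eq_0)
  also have "\<dots> = (1 - b * e * Q ^ M) * qpoch e Q M"
    unfolding Suc.IH[of b, symmetric] sum_distrib_left
    by (intro sum.cong refl) (subst low, auto simp: mult_ac)
  also have "(\<Sum>m\<le>M. Q ^ (M - m) * qbin Q M m * ?t b (Suc M) (Suc m))
      = (\<Sum>m\<le>M. qbin Q M m * (Q ^ (M - m) * ?t b (Suc M) (Suc m)))"
    by (simp add: mult_ac)
  also have "\<dots> = - e * Q ^ M * (1 - b) * qpoch e Q M"
    unfolding Suc.IH[of "b * Q", symmetric] sum_distrib_left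
    by (intro sum.cong refl) (subst high, auto simp: mult_ac)
  finally show ?case
    by (simp add: qpoch_Suc algebra_simps)
qed

text \<open>Here and below \<open>iq n\<close> plays the role of 1 / (Q; Q)_n. It enters as a
  hypothesis, so the finite identities can be stated in a general ring and used for power series
  later.\<close>

lemma qbin_eq_inverses:
  fixes Q :: "'a::comm_ring_1"
  assumes inv: "\<And>n. iq n * qpoch Q Q n = 1" and "m \<le> M"
  shows "qbin Q M m = qpoch Q Q M * iq m * iq (M - m)"
proof -
  have "qbin Q M m * 1 * 1 = qbin Q M m * (iq m * qpoch Q Q m) * (iq (M - m) * qpoch Q Q (M - m))"
    unfolding inv ..
  also have "\<dots> = (qbin Q (m + (M - m)) m * (qpoch Q Q m * qpoch Q Q (M - m))) * (iq m * iq (M - m))"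
    using assms(2) by (simp add: mult_ac)
  finally show ?thesis
    unfolding qbin_mult_qpoch using assms(2) by (simp add: mult_ac)
qed

section \<open>Bailey's lemma and the finite triple product\<close>

text \<open>Here \<open>b\<close> is the parameter \<rho>_1 and \<open>d\<close> is Q^2 / \<rho>_1.
  The usual denominator (Q^2; Q)_(n+r) becomes (Q; Q)_(n+r+1), with the factor 1 - Q absorbed into
  \<alpha>. Inserting the definition of \<beta> and exchanging the sums leaves, for each
  \<open>r\<close>, a q-Chu-Vandermonde sum.\<close>

lemma bailey_step:
  fixes Q :: "'a::comm_ring_1"
  assumes inv: "\<And>n. iq n * qpoch Q Q n = 1"
    and bd: "b * d = Q ^ 2"
    and beta: "\<And>n. \<beta> n = (\<Sum>r\<le>n. \<alpha> r * iq (n - r) * iq (n + r + 1))"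
  shows "(\<Sum>n\<le>L. qpoch b Q n * (- d) ^ n * Q ^ (n choose 2) * \<beta> n * iq (L - n))
    = (\<Sum>r\<le>L. \<alpha> r * qpoch b Q r * (- d) ^ r * Q ^ (r choose 2) * qpoch (d * Q ^ r) Q (L - r)
        * iq (L - r) * iq (L + r + 1))"
proof -
  have qbin: "qbin Q M m * iq M = iq m * iq (M - m)" if "m \<le> M" for m M
  proof -
    have "qbin Q M m * iq M = (iq M * qpoch Q Q M) * (iq m * iq (M - m))"
      using qbin_eq_inverses[of iq, OF inv that] by (simp add: mult_ac)
    then show ?thesis by (simp add: inv)
  qed
  \<comment> \<open>q-Chu-Vandermonde with parameters b Q^r and d Q^r, multiplied by the two
    inverses on the right.\<close>
  have inner: "(\<Sum>m\<le>M. qpoch (b * Q ^ r) Q m * (- (d * Q ^ r)) ^ m * Q ^ (m choose 2)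
        * iq (M - m) * iq m * iq (m + 2 * r + 1))
      = qpoch (d * Q ^ r) Q M * iq M * iq (M + 2 * r + 1)" for M r
  proof -
    have be: "b * Q ^ r * (d * Q ^ r) = Q * Q ^ (2 * r + 1)"
    proof -
      have "b * Q ^ r * (d * Q ^ r) = b * d * (Q ^ r * Q ^ r)"
        by (simp add: mult_ac)
      also have "\<dots> = Q * Q ^ (2 * r + 1)"
        unfolding bd by (simp add: power2_eq_square mult_2 power_add mult.assoc)
      finally show ?thesis .
    qed
    \<comment> \<open>As b d Q^(2r) = Q^(2r+2), this shifted factorial is (Q; Q)_(M+2r+1) divided by
      (Q; Q)_(m+2r+1).\<close>
    have shift: "qpoch (b * Q ^ r * (d * Q ^ r) * Q ^ m) Q (M - m) * iq (M + 2 * r + 1) = iq (m + 2 * r + 1)"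
      if "m \<le> M" for m
    proof -
      have "b * Q ^ r * (d * Q ^ r) * Q ^ m = Q * Q ^ (m + 2 * r + 1)"
        unfolding be by (simp add: power_add mult_ac)
      moreover have "m + 2 * r + 1 + (M - m) = M + 2 * r + 1"
        using that by simp
      ultimately have "qpoch Q Q (M + 2 * r + 1)
          = qpoch Q Q (m + 2 * r + 1) * qpoch (b * Q ^ r * (d * Q ^ r) * Q ^ m) Q (M - m)"
        using qpoch_add[of Q Q "m + 2 * r + 1" "M - m"] by (simp only:)
      then have R: "iq (M + 2 * r + 1) * (qpoch Q Q (m + 2 * r + 1)
          * qpoch (b * Q ^ r * (d * Q ^ r) * Q ^ m) Q (M - m)) = 1"
        using inv[of "M + 2 * r + 1"] by (simp only:)
      have "qpoch (b * Q ^ r * (d * Q ^ r) * Q ^ m) Q (M - m) * iq (M + 2 * r + 1)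
          = (iq (m + 2 * r + 1) * qpoch Q Q (m + 2 * r + 1))
            * (qpoch (b * Q ^ r * (d * Q ^ r) * Q ^ m) Q (M - m) * iq (M + 2 * r + 1))"
        by (simp only: inv mult_1_left)
      also have "\<dots> = iq (m + 2 * r + 1) * (iq (M + 2 * r + 1) * (qpoch Q Q (m + 2 * r + 1)
          * qpoch (b * Q ^ r * (d * Q ^ r) * Q ^ m) Q (M - m)))"
        by (simp only: mult_ac)
      finally show ?thesis
        by (simp only: R mult_1_right)
    qed
    have "qpoch (d * Q ^ r) Q M * iq M * iq (M + 2 * r + 1)
        = (\<Sum>m\<le>M. qpoch (b * Q ^ r) Q m * (- (d * Q ^ r)) ^ m * Q ^ (m choose 2)
            * (qbin Q M m * iq M)
            * (qpoch (b * Q ^ r * (d * Q ^ r) * Q ^ m) Q (M - m) * iq (M + 2 * r + 1)))"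
      unfolding q_chu_vandermonde[where b = "b * Q ^ r" and e = "d * Q ^ r", symmetric] sum_distrib_right
      by (intro sum.cong refl) (simp add: mult_ac)
    also have "\<dots> = (\<Sum>m\<le>M. qpoch (b * Q ^ r) Q m * (- (d * Q ^ r)) ^ m * Q ^ (m choose 2)
        * iq (M - m) * iq m * iq (m + 2 * r + 1))"
      by (intro sum.cong refl) (simp only: shift qbin atMost_iff, simp only: mult_ac)
    finally show ?thesis by simp
  qed
  let ?f = "\<lambda>n r. qpoch b Q n * (- d) ^ n * Q ^ (n choose 2) * (\<alpha> r * iq (n - r) * iq (n + r + 1)) * iq (L - n)"
  have "(\<Sum>n\<le>L. qpoch b Q n * (- d) ^ n * Q ^ (n choose 2) * \<beta> n * iq (L - n))
      = (\<Sum>n\<le>L. \<Sum>r\<le>n. ?f n r)"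
    by (simp add: beta sum_distrib_left sum_distrib_right)
  also have "\<dots> = (\<Sum>(n, r)\<in>(SIGMA n:{..L}. {..n}). ?f n r)"
    by (rule sum.Sigma) auto
  \<comment> \<open>Exchange of summation: \<open>r\<close> becomes the outer index and n = r +
    m.\<close>
  also have "\<dots> = (\<Sum>(r, m)\<in>(SIGMA r:{..L}. {..L - r}). ?f (r + m) r)"
    by (rule sum.reindex_bij_witness[where i = "\<lambda>(r, m). (r + m, r)" and j = "\<lambda>(n, r). (r, n - r)"]) auto
  also have "\<dots> = (\<Sum>r\<le>L. \<Sum>m\<le>L - r. ?f (r + m) r)"
    by (rule sum.Sigma[symmetric]) auto
  also have "\<dots> = (\<Sum>r\<le>L. \<alpha> r * qpoch b Q r * (- d) ^ r * Q ^ (r choose 2) * qpoch (d * Q ^ r) Q (L - r)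
        * iq (L - r) * iq (L + r + 1))"
  proof (intro sum.cong refl)
    fix r assume "r \<in> {..L}"
    then have rL: "r \<le> L" by simp
    have "(\<Sum>m\<le>L - r. ?f (r + m) r) = \<alpha> r * qpoch b Q r * (- d) ^ r * Q ^ (r choose 2)
        * (\<Sum>m\<le>L - r. qpoch (b * Q ^ r) Q m * (- (d * Q ^ r)) ^ m * Q ^ (m choose 2)
            * iq (L - r - m) * iq m * iq (m + 2 * r + 1))"
      unfolding sum_distrib_left
    proof (intro sum.cong refl)
      fix m
      have idx: "r + m + r + 1 = m + 2 * r + 1" by simp
      have pw: "(- (d * Q ^ r)) ^ m = (- d) ^ m * Q ^ (r * m)"
        by (metis mult_minus_left power_mult power_mult_distrib)
      show "?f (r + m) r = \<alpha> r * qpoch b Q r * (- d) ^ r * Q ^ (r choose 2)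
        * (qpoch (b * Q ^ r) Q m * (- (d * Q ^ r)) ^ m * Q ^ (m choose 2)
            * iq (L - r - m) * iq m * iq (m + 2 * r + 1))"
        unfolding idx pw qpoch_add add_choose_two power_add[of "- d"] power_add[of Q "_ + _"] power_add[of Q "_ choose _"]
        by (simp add: mult_ac)
    qed
    also have "\<dots> = \<alpha> r * qpoch b Q r * (- d) ^ r * Q ^ (r choose 2)
        * (qpoch (d * Q ^ r) Q (L - r) * iq (L - r) * iq (L + r + 1))"
      unfolding inner using rL by (simp add: add_ac)
    finally show "(\<Sum>m\<le>L - r. ?f (r + m) r) = \<alpha> r * qpoch b Q r * (- d) ^ r * Q ^ (r choose 2)
        * qpoch (d * Q ^ r) Q (L - r) * iq (L - r) * iq (L + r + 1)"
      by (simp add: mult_ac)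
  qed
  finally show ?thesis .
qed

section \<open>The q-binomial theorem and the finite triple product\<close>

text \<open>The q-binomial theorem, by the Pascal rule. The second variable \<open>y\<close> lets it
  be used at y = Q^n, where the inhomogeneous form would need negative powers of Q.\<close>

lemma q_binomial_homogeneous:
  fixes Q :: "'a::comm_ring_1"
  shows "(\<Sum>k\<le>N. qbin Q N k * ((- x) ^ k * Q ^ (k choose 2) * y ^ (N - k))) = (\<Prod>i<N. y - x * Q ^ i)"
proof (induction N)
  case 0
  show ?case by (simp add: binomial_eq_0)
next
  case (Suc N)
  let ?t = "\<lambda>N k. (- x) ^ k * Q ^ (k choose 2) * y ^ (N - k)"
  have high: "Q ^ (N - k) * ?t (Suc N) (Suc k) = - x * Q ^ N * ?t N k" if "k \<le> N" for k
  proof -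
    have "Q ^ N = Q ^ (N - k) * Q ^ k"
      using that by (simp flip: power_add)
    then show ?thesis
      by (simp add: Suc_choose_two power_add mult_ac)
  qed
  have "(\<Sum>k\<le>Suc N. qbin Q (Suc N) k * ?t (Suc N) k)
      = ?t (Suc N) 0 + (\<Sum>k\<le>N. qbin Q (Suc N) (Suc k) * ?t (Suc N) (Suc k))"
    by (simp add: sum.atMost_Suc_shift binomial_eq_0 del: sum.atMost_Suc qbin.simps(3))
  also have "\<dots> = (?t (Suc N) 0 + (\<Sum>k\<le>N. qbin Q N (Suc k) * ?t (Suc N) (Suc k)))
      + (\<Sum>k\<le>N. Q ^ (N - k) * qbin Q N k * ?t (Suc N) (Suc k))"
    by (simp only: qbin.simps(3) distrib_right sum.distrib add.assoc)
  also have "?t (Suc N) 0 + (\<Sum>k\<le>N. qbin Q N (Suc k) * ?t (Suc N) (Suc k))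
      = (\<Sum>k\<le>Suc N. qbin Q N k * ?t (Suc N) k)"
    by (simp add: sum.atMost_Suc_shift del: sum.atMost_Suc)
  also have "\<dots> = (\<Sum>k\<le>N. qbin Q N k * ?t (Suc N) k)"
    by (simp add: qbin_eq_0)
  also have "\<dots> = y * (\<Prod>i<N. y - x * Q ^ i)"
    unfolding Suc.IH[symmetric] sum_distrib_left
    by (intro sum.cong refl) (auto simp: Suc_diff_le mult_ac)
  also have "(\<Sum>k\<le>N. Q ^ (N - k) * qbin Q N k * ?t (Suc N) (Suc k))
      = (\<Sum>k\<le>N. qbin Q N k * (Q ^ (N - k) * ?t (Suc N) (Suc k)))"
    by (simp add: mult_ac)
  also have "\<dots> = - x * Q ^ N * (\<Prod>i<N. y - x * Q ^ i)"
    unfolding Suc.IH[symmetric] sum_distrib_left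
    by (intro sum.cong refl) (subst high, auto simp: mult_ac)
  finally show ?case
    by (simp add: algebra_simps)
qed

lemma double_choose_two: "2 * (r choose 2) + r = r * r"
  by (induction r) (simp_all add: Suc_choose_two binomial_eq_0)

text \<open>The q-binomial theorem with 2n+1 factors, x = z and y = Q^n. The terms k = n - r and k =
  n + 1 + r have the same Gaussian binomial, and pairing them folds the two-sided sum into one over
  r \<ge> 0. A common monomial is then cancelled.\<close>

lemma finite_jacobi_triple_product:
  fixes Q :: "'a::idom"
  assumes inv: "\<And>n. iq n * qpoch Q Q n = 1"
    and zw: "z * w = Q" and "Q \<noteq> 0"
  shows "(\<Sum>r\<le>n. (- 1) ^ r * (w ^ r * Q ^ (r choose 2) - z ^ (r + 1) * Q ^ (Suc r choose 2))
      * iq (n - r) * iq (n + r + 1)) = iq (2 * n + 1) * qpoch z Q (n + 1) * qpoch w Q n"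
proof -
  let ?N = "2 * n + 1"
  let ?f = "\<lambda>k. qbin Q ?N k * ((- z) ^ k * Q ^ (k choose 2) * (Q ^ n) ^ (?N - k))"
  \<comment> \<open>The term k = n of the expansion without its Gaussian binomial; it divides all
    terms and the product side.\<close>
  define c where "c = (- z) ^ n * Q ^ (n choose 2) * Q ^ (n * (n + 1))"
  define p where "p r = qpoch Q Q ?N * iq (n - r) * iq (n + r + 1)" for r
  have c0: "c \<noteq> 0"
    using zw \<open>Q \<noteq> 0\<close> by (auto simp: c_def)
  have low: "?f (n - r) = c * ((- 1) ^ r * (w ^ r * Q ^ (r choose 2)) * p r)" if rn: "r \<le> n" for r
  proof -
    obtain s where n: "n = r + s"
      using le_Suc_ex[OF rn] by blast
    have "qbin Q ?N (n - r) = p r"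
    proof -
      have "?N - (n - r) = n + r + 1"
        using rn by simp
      then show ?thesis
        using qbin_eq_inverses[of iq, OF inv, of "n - r" ?N] unfolding p_def by simp
    qed
    moreover have ns: "n - r = s"
      by (simp add: n)
    moreover have "(- z) ^ (n - r) * Q ^ (n - r choose 2) * (Q ^ n) ^ (?N - (n - r))
        = c * ((- 1) ^ r * (w ^ r * Q ^ (r choose 2)))"
    proof -
      have e: "(s choose 2) + n * (?N - s) = (n choose 2) + n * (n + 1) + (r choose 2) + r"
        using double_choose_two[of r] by (simp add: n add_choose_two algebra_simps)
      have "(- z) ^ (n - r) * Q ^ (n - r choose 2) * (Q ^ n) ^ (?N - (n - r))
          = (- z) ^ s * Q ^ ((s choose 2) + n * (?N - s))"
        by (simp add: ns power_add power_mult)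
      also have "\<dots> = (- z) ^ s * (Q ^ (n choose 2) * Q ^ (n * (n + 1)) * Q ^ (r choose 2)) * (z * w) ^ r"
        unfolding e zw by (simp only: power_add mult_ac)
      also have "(z * w) ^ r = (- z) ^ r * ((- 1) ^ r * w ^ r)"
        by (simp flip: power_mult_distrib)
      also have "(- z) ^ s * (Q ^ (n choose 2) * Q ^ (n * (n + 1)) * Q ^ (r choose 2)) * ((- z) ^ r * ((- 1) ^ r * w ^ r))
          = c * ((- 1) ^ r * (w ^ r * Q ^ (r choose 2)))"
      proof -
        have "(- z) ^ n = (- z) ^ r * (- z) ^ s"
          by (simp add: n power_add)
        then show ?thesis
          by (simp only: c_def mult_ac)
      qed
      finally show ?thesis .
    qed
    ultimately show ?thesis
      by (simp add: mult_ac)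
  qed
  have high: "?f (n + 1 + r) = c * (- ((- 1) ^ r * (z ^ (r + 1) * Q ^ (Suc r choose 2)) * p r))"
    if rn: "r \<le> n" for r
  proof -
    obtain s where n: "n = r + s"
      using le_Suc_ex[OF rn] by blast
    have "qbin Q ?N (n + 1 + r) = p r"
    proof -
      have "?N - (n + r + 1) = n - r" "n + r + 1 \<le> ?N"
        using rn by simp_all
      then have "qbin Q ?N (n + r + 1) = qpoch Q Q ?N * iq (n + r + 1) * iq (n - r)"
        using qbin_eq_inverses[of iq, OF inv, of "n + r + 1" ?N] by simp
      then show ?thesis
        by (simp add: p_def mult_ac add_ac)
    qed
    moreover have "(- z) ^ (n + 1 + r) * Q ^ (n + 1 + r choose 2) * (Q ^ n) ^ (?N - (n + 1 + r))
        = c * (- ((- 1) ^ r * (z ^ (r + 1) * Q ^ (Suc r choose 2))))"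
    proof -
      have e: "(n + 1 + r choose 2) + n * (?N - (n + 1 + r))
          = (n choose 2) + n * (n + 1) + (Suc r choose 2)"
      proof -
        have "?N - (n + 1 + r) = s" "n + 1 = Suc r + s"
          by (simp_all add: n)
        then show ?thesis
          using add_choose_two[of n "Suc r"] by (simp add: distrib_left)
      qed
      have "(- z) ^ (n + 1 + r) * Q ^ (n + 1 + r choose 2) * (Q ^ n) ^ (?N - (n + 1 + r))
          = (- z) ^ (n + 1 + r) * Q ^ ((n + 1 + r choose 2) + n * (?N - (n + 1 + r)))"
        by (simp only: power_add power_mult mult.assoc)
      also have "\<dots> = (- z) ^ n * (- z) ^ (r + 1) * (Q ^ (n choose 2) * Q ^ (n * (n + 1)) * Q ^ (Suc r choose 2))"
        unfolding e
        unfolding add.assoc[of n 1 r] add.commute[of 1 r] power_add[of "- z" n "r + 1"]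
          power_add[of Q "_ + _" "Suc r choose 2"] power_add[of Q "n choose 2" "n * (n + 1)"]
        by (simp only: mult_ac)
      also have "(- z) ^ (r + 1) = - ((- 1) ^ r * z ^ (r + 1))"
        by (subst power_minus) simp
      finally show ?thesis
        by (simp add: c_def mult_ac)
    qed
    ultimately show ?thesis
      by (simp only: mult_minus_left mult_minus_right mult_ac)
  qed
  have split: "(\<Prod>i<a + b. g i) = (\<Prod>i<a. g i) * (\<Prod>i<b. g (a + i))" for a b and g :: "nat \<Rightarrow> 'a"
    by (induction b) (simp_all add: mult.assoc)
  have "(\<Prod>i<?N. Q ^ n - z * Q ^ i) = (\<Prod>i<n + (n + 1). Q ^ n - z * Q ^ i)"
    by (simp add: mult_2)
  also have "\<dots> = (\<Prod>i<n. Q ^ n - z * Q ^ i) * (\<Prod>i<n + 1. Q ^ n - z * Q ^ (n + i))"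
    by (rule split)
  also have "(\<Prod>i<n + 1. Q ^ n - z * Q ^ (n + i)) = (\<Prod>i<n + 1. Q ^ n * (1 - z * Q ^ i))"
    by (simp add: algebra_simps power_add)
  also have "\<dots> = Q ^ (n * (n + 1)) * qpoch z Q (n + 1)"
    unfolding prod.distrib qpoch_def by (simp add: power_mult power_add)
  \<comment> \<open>By Q = z w, the monomial -z Q^i can be taken out of each of the first
    \<open>n\<close> factors; what remains is (w; Q)_n in reversed order.\<close>
  also have "(\<Prod>i<n. Q ^ n - z * Q ^ i) = (\<Prod>i<n. (- z * Q ^ i) * (1 - w * Q ^ (n - Suc i)))"
  proof (intro prod.cong refl)
    fix i assume "i \<in> {..<n}"
    then have "n = Suc (i + (n - Suc i))" by simp
    then have "Q ^ n = Q * (Q ^ i * Q ^ (n - Suc i))"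
      by (metis power_Suc power_add)
    also have "\<dots> = z * w * (Q ^ i * Q ^ (n - Suc i))"
      by (simp only: zw)
    finally show "Q ^ n - z * Q ^ i = (- z * Q ^ i) * (1 - w * Q ^ (n - Suc i))"
      by (simp add: algebra_simps)
  qed
  also have "\<dots> = (\<Prod>i<n. - z * Q ^ i) * qpoch w Q n"
    unfolding prod.distrib qpoch_def
    using prod.nat_diff_reindex[of "\<lambda>i. 1 - w * Q ^ i" n] by simp
  also have "(\<Prod>i<n. - z * Q ^ i) = (- z) ^ n * Q ^ (n choose 2)"
    by (induction n) (simp_all add: Suc_choose_two binomial_eq_0 power_add mult_ac)
  finally have prod: "(\<Prod>i<?N. Q ^ n - z * Q ^ i) = c * (qpoch z Q (n + 1) * qpoch w Q n)"
    by (simp add: c_def mult_ac)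
  have "(\<Sum>k\<le>?N. ?f k) = (\<Sum>k\<le>n. ?f k) + (\<Sum>k\<in>{n + 1..n + (n + 1)}. ?f k)"
    using sum_up_index_split[of ?f n "n + 1"] by (simp add: mult_2)
  also have "(\<Sum>k\<le>n. ?f k) = (\<Sum>r\<le>n. ?f (n - r))"
    by (rule sum.reindex_bij_witness[where i = "\<lambda>r. n - r" and j = "\<lambda>r. n - r"]) auto
  also have "(\<Sum>k\<in>{n + 1..n + (n + 1)}. ?f k) = (\<Sum>r\<le>n. ?f (n + 1 + r))"
    by (rule sum.reindex_bij_witness[where i = "\<lambda>r. n + 1 + r" and j = "\<lambda>k. k - (n + 1)"]) auto
  also have "(\<Sum>r\<le>n. ?f (n - r)) + (\<Sum>r\<le>n. ?f (n + 1 + r))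
      = c * (\<Sum>r\<le>n. (- 1) ^ r * (w ^ r * Q ^ (r choose 2) - z ^ (r + 1) * Q ^ (Suc r choose 2)) * p r)"
    unfolding sum.distrib[symmetric] sum_distrib_left
    by (intro sum.cong refl) (simp only: low high atMost_iff, simp add: algebra_simps)
  finally have "c * (\<Sum>r\<le>n. (- 1) ^ r * (w ^ r * Q ^ (r choose 2) - z ^ (r + 1) * Q ^ (Suc r choose 2)) * p r)
      = c * (qpoch z Q (n + 1) * qpoch w Q n)"
    unfolding q_binomial_homogeneous prod by (rule sym)
  then have *: "(\<Sum>r\<le>n. (- 1) ^ r * (w ^ r * Q ^ (r choose 2) - z ^ (r + 1) * Q ^ (Suc r choose 2)) * p r)
      = qpoch z Q (n + 1) * qpoch w Q n"
    using c0 by simp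
  have "iq ?N * p r = iq (n - r) * iq (n + r + 1)" for r
    using inv[of ?N] by (simp add: p_def flip: mult.assoc)
  then show ?thesis
    unfolding mult.assoc *[symmetric] sum_distrib_left
    by (intro sum.cong refl) (simp add: mult.left_commute)
qed

section \<open>Two Bailey pairs and the finite Slater identity\<close>

text \<open>The finite triple product at z = Q, w = 1, where the factor (1; Q)_n vanishes for n >
  0.\<close>

lemma unit_bailey_pair:
  fixes Q :: "'a::idom"
  assumes inv: "\<And>n. iq n * qpoch Q Q n = 1" and "Q \<noteq> 0"
  shows "(\<Sum>r\<le>n. (- 1) ^ r * Q ^ (r choose 2) * (1 - Q ^ (2 * r + 1)) * iq (n - r) * iq (n + r + 1))
    = (if n = 0 then 1 else 0)"
proof -
  have e: "1 ^ r * Q ^ (r choose 2) - Q ^ (r + 1) * Q ^ (Suc r choose 2)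
      = Q ^ (r choose 2) * (1 - Q ^ (2 * r + 1))" for r
    by (simp add: Suc_choose_two power_add power_mult power2_eq_square power_mult_distrib algebra_simps)
  have "(\<Sum>r\<le>n. (- 1) ^ r * Q ^ (r choose 2) * (1 - Q ^ (2 * r + 1)) * iq (n - r) * iq (n + r + 1))
      = iq (2 * n + 1) * qpoch Q Q (n + 1) * qpoch 1 Q n"
    using finite_jacobi_triple_product[of iq Q Q 1 n, OF inv] \<open>Q \<noteq> 0\<close>
    unfolding e by (simp add: mult_ac)
  also have "\<dots> = (if n = 0 then 1 else 0)"
    using inv[of 1] by (cases n) (simp_all add: qpoch_Suc_left)
  finally show ?thesis .
qed

text \<open>\<open>bailey_step\<close> with b = d = -Q, applied to the unit pair. On the right, (-Q;
  Q)_r and (-Q^(r+1); Q)_(n-r) combine to (-Q; Q)_n, which no longer depends on \<open>r\<close>. In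
  effect \<beta>_n = 1 / ((Q; Q)_n (-Q; Q)_n).\<close>

lemma gauss_bailey_pair:
  fixes Q :: "'a::idom"
  assumes inv: "\<And>n. iq n * qpoch Q Q n = 1" and "Q \<noteq> 0"
  shows "qpoch (- Q) Q n
      * (\<Sum>r\<le>n. (- 1) ^ r * Q ^ (r * r) * (1 - Q ^ (2 * r + 1)) * iq (n - r) * iq (n + r + 1)) = iq n"
proof -
  let ?\<alpha> = "\<lambda>r. (- 1) ^ r * Q ^ (r choose 2) * (1 - Q ^ (2 * r + 1))"
  let ?\<beta> = "\<lambda>n::nat. if n = 0 then 1 else 0 :: 'a"
  \<comment> \<open>The unit pair keeps only the term k = 0.\<close>
  have "iq n = (\<Sum>k\<le>n. qpoch (- Q) Q k * (- (- Q)) ^ k * Q ^ (k choose 2) * ?\<beta> k * iq (n - k))"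
    by (subst sum.mono_neutral_right[of _ "{0}"]) (auto simp: binomial_eq_0)
  also have "\<dots> = (\<Sum>r\<le>n. ?\<alpha> r * qpoch (- Q) Q r * (- (- Q)) ^ r * Q ^ (r choose 2)
      * qpoch (- Q * Q ^ r) Q (n - r) * iq (n - r) * iq (n + r + 1))"
    by (rule bailey_step[OF inv]) (use unit_bailey_pair[of iq, OF inv \<open>Q \<noteq> 0\<close>] in \<open>simp_all add: power2_eq_square\<close>)
  also have "\<dots> = (\<Sum>r\<le>n. qpoch (- Q) Q n * ((- 1) ^ r * Q ^ (r * r) * (1 - Q ^ (2 * r + 1)) * iq (n - r) * iq (n + r + 1)))"
  proof (intro sum.cong refl)
    fix r assume "r \<in> {..n}"
    then have "qpoch (- Q) Q n = qpoch (- Q) Q r * qpoch (- Q * Q ^ r) Q (n - r)"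
      using qpoch_add[of "- Q" Q r "n - r"] by simp
    moreover have "Q ^ (r * r) = Q ^ (r choose 2) * Q ^ (r choose 2) * Q ^ r"
      unfolding double_choose_two[of r, symmetric] by (simp add: power_add mult_2)
    ultimately show "?\<alpha> r * qpoch (- Q) Q r * (- (- Q)) ^ r * Q ^ (r choose 2)
        * qpoch (- Q * Q ^ r) Q (n - r) * iq (n - r) * iq (n + r + 1)
      = qpoch (- Q) Q n * ((- 1) ^ r * Q ^ (r * r) * (1 - Q ^ (2 * r + 1)) * iq (n - r) * iq (n + r + 1))"
      by (simp add: mult_ac)
  qed
  finally show ?thesis
    by (simp add: sum_distrib_left)
qed

lemma qpoch_square: "qpoch (x * x) (Q * Q) n = qpoch x Q n * qpoch (- x) Q n"
  by (induction n) (simp_all add: qpoch_Suc power_mult_distrib algebra_simps)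

text \<open>\<open>bailey_step\<close> with base Q = q^2, b = -q and d = -q^3, applied to the pair
  of \<open>gauss_bailey_pair\<close>.\<close>

lemma slater_finite:
  fixes q :: "'a::idom"
  assumes inv: "\<And>n. iq n * qpoch (q ^ 2) (q ^ 2) n = 1"
    and inv4: "\<And>n. i4 n * qpoch (q ^ 4) (q ^ 4) n = 1" and "q \<noteq> 0"
  shows "(\<Sum>n\<le>L. q ^ (n * n + 2 * n) * qpoch (- q) (q ^ 2) n * i4 n * iq (L - n))
    = qpoch (- q) (q ^ 2) (L + 1)
      * (\<Sum>r\<le>L. (- 1) ^ r * q ^ (3 * r * r + 2 * r) * (1 - q ^ (2 * r + 1)) * iq (L - r) * iq (L + r + 1))"
proof -
  define Q where "Q = q ^ 2"
  have inv': "iq n * qpoch Q Q n = 1" for n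
    using inv by (simp add: Q_def)
  have Q0: "Q \<noteq> 0"
    using \<open>q \<noteq> 0\<close> by (simp add: Q_def)
  let ?\<alpha> = "\<lambda>r. (- 1) ^ r * Q ^ (r * r) * (1 - Q ^ (2 * r + 1))"
  \<comment> \<open>Both sides are inverses of (q^4; q^4)_n = (Q; Q)_n (-Q; Q)_n, and inverses are
    unique.\<close>
  have beta: "i4 n = (\<Sum>r\<le>n. ?\<alpha> r * iq (n - r) * iq (n + r + 1))" (is "_ = ?\<beta>") for n
  proof -
    have "qpoch (- Q) Q n * ?\<beta> * qpoch Q Q n = 1"
      using gauss_bailey_pair[of iq, OF inv' Q0, of n] inv'[of n] by simp
    moreover have "qpoch (q ^ 4) (q ^ 4) n = qpoch Q Q n * qpoch (- Q) Q n"
      using qpoch_square[of Q Q n] by (simp add: Q_def flip: power_add)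
    ultimately have "qpoch (q ^ 4) (q ^ 4) n * ?\<beta> = 1"
      by (simp only: mult_ac)
    then show ?thesis
      using inv4[of n] mult.assoc[of "i4 n" "qpoch (q ^ 4) (q ^ 4) n" ?\<beta>] by simp
  qed
  have choose: "Q ^ (r choose 2) * q ^ r = q ^ (r * r)" for r
    unfolding double_choose_two[of r, symmetric] Q_def by (simp add: power_add flip: power_mult)
  have "(\<Sum>n\<le>L. q ^ (n * n + 2 * n) * qpoch (- q) Q n * i4 n * iq (L - n))
      = (\<Sum>n\<le>L. qpoch (- q) Q n * (- (- (q ^ 3))) ^ n * Q ^ (n choose 2) * i4 n * iq (L - n))"
  proof (intro sum.cong refl)
    fix n
    have "q ^ (n * n + 2 * n) = (q ^ 3) ^ n * Q ^ (n choose 2)"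
    proof -
      have "(q ^ 3) ^ n = q ^ n * q ^ (2 * n)"
        by (simp flip: power_mult power_add)
      then show ?thesis
        by (simp only: power_add choose[symmetric] mult_ac)
    qed
    then show "q ^ (n * n + 2 * n) * qpoch (- q) Q n * i4 n * iq (L - n)
        = qpoch (- q) Q n * (- (- (q ^ 3))) ^ n * Q ^ (n choose 2) * i4 n * iq (L - n)"
      by (simp add: mult_ac)
  qed
  also have "\<dots> = (\<Sum>r\<le>L. ?\<alpha> r * qpoch (- q) Q r * (- (- (q ^ 3))) ^ r * Q ^ (r choose 2)
      * qpoch (- (q ^ 3) * Q ^ r) Q (L - r) * iq (L - r) * iq (L + r + 1))"
    by (rule bailey_step[OF inv' _ beta]) (simp add: Q_def power2_eq_square power3_eq_cube mult_ac)
  also have "\<dots> = (\<Sum>r\<le>L. qpoch (- q) Q (L + 1)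
      * ((- 1) ^ r * q ^ (3 * r * r + 2 * r) * (1 - q ^ (2 * r + 1)) * iq (L - r) * iq (L + r + 1)))"
  proof (intro sum.cong refl)
    fix r assume r: "r \<in> {..L}"
    \<comment> \<open>The shifted factorials with parameters -q and -q^3 Q^r leave out exactly the
      factor 1 + q^(2r+1) of (-q; Q)_(L+1). It is supplied by 1 - Q^(2r+1), whose other factor is 1
      - q^(2r+1).\<close>
    have pr: "qpoch (- q) Q (L + 1)
        = qpoch (- q) Q r * ((1 + q ^ (2 * r + 1)) * qpoch (- (q ^ 3) * Q ^ r) Q (L - r))"
      using qpoch_add[of "- q" Q r "Suc (L - r)"] r
      unfolding qpoch_Suc_left by (simp add: Q_def power2_eq_square power3_eq_cube power_mult power_mult_distrib mult_ac)
    have sq: "1 - Q ^ (2 * r + 1) = (1 - q ^ (2 * r + 1)) * (1 + q ^ (2 * r + 1))"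
      by (simp add: Q_def power2_eq_square power_mult_distrib algebra_simps)
    have pw: "Q ^ (r * r) * (q ^ 3) ^ r * Q ^ (r choose 2) = q ^ (3 * r * r + 2 * r)"
    proof -
      have "(q ^ 3) ^ r = q ^ r * q ^ (2 * r)"
        by (simp add: flip: power_mult power_add)
      then have "Q ^ (r * r) * (q ^ 3) ^ r * Q ^ (r choose 2) = Q ^ (r * r) * q ^ (2 * r) * (Q ^ (r choose 2) * q ^ r)"
        by (simp only: mult_ac)
      also have "\<dots> = q ^ (3 * r * r + 2 * r)"
        unfolding choose unfolding Q_def by (simp add: mult.assoc flip: power_mult power_add)
      finally show ?thesis .
    qed
    show "?\<alpha> r * qpoch (- q) Q r * (- (- (q ^ 3))) ^ r * Q ^ (r choose 2)
        * qpoch (- (q ^ 3) * Q ^ r) Q (L - r) * iq (L - r) * iq (L + r + 1)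
      = qpoch (- q) Q (L + 1)
      * ((- 1) ^ r * q ^ (3 * r * r + 2 * r) * (1 - q ^ (2 * r + 1)) * iq (L - r) * iq (L + r + 1))"
      unfolding pr sq pw[symmetric] by (simp add: mult_ac)
  qed
  finally show ?thesis
    by (simp add: sum_distrib_left Q_def)
qed

section \<open>Truncated power series\<close>

text \<open>Congruence modulo \<open>fps_X ^ m\<close>. It replaces limits and infinite products:
  each finite identity is read modulo a power that grows with its length.\<close>

definition fps_agree :: "nat \<Rightarrow> 'a::field fps \<Rightarrow> 'a fps \<Rightarrow> bool" where
  "fps_agree m f g \<longleftrightarrow> (\<forall>i<m. fps_nth f i = fps_nth g i)"

lemma fps_agree_refl [simp]: "fps_agree m f f"
  by (simp add: fps_agree_def)

lemma fps_agree_sym: "fps_agree m f g \<Longrightarrow> fps_agree m g f"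
  by (simp add: fps_agree_def)

lemma fps_agree_trans [trans]: "fps_agree m f g \<Longrightarrow> fps_agree m g h \<Longrightarrow> fps_agree m f h"
  by (simp add: fps_agree_def)

lemma fps_agree_mult:
  "fps_agree m f f' \<Longrightarrow> fps_agree m g g' \<Longrightarrow> fps_agree m (f * g) (f' * g')"
  by (simp add: fps_agree_def fps_mult_nth)

lemma fps_agree_sum:
  "(\<And>x. x \<in> A \<Longrightarrow> fps_agree m (f x) (g x)) \<Longrightarrow> fps_agree m (\<Sum>x\<in>A. f x) (\<Sum>x\<in>A. g x)"
  by (simp add: fps_agree_def fps_sum_nth)

lemma fps_agree_X_power:
  "fps_agree (m - k) f g \<Longrightarrow> fps_agree m (fps_X ^ k * f) (fps_X ^ k * g)"
  by (auto simp: fps_agree_def fps_X_power_mult_nth)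

lemma fps_agree_inverse:
  assumes "fps_agree m f g" "fps_nth f 0 \<noteq> 0" "fps_nth g 0 \<noteq> 0"
  shows "fps_agree m (inverse f) (inverse g)"
proof -
  have "fps_agree m (inverse f * inverse g * g) (inverse f * inverse g * f)"
    by (intro fps_agree_mult fps_agree_sym[OF assms(1)]) simp_all
  then show ?thesis
    using assms(2,3) by (simp add: inverse_mult_eq_1 mult.assoc mult.left_commute[of "inverse f" "inverse g" f])
qed

lemma fps_agree_cancel:
  assumes "fps_agree m (f * h) (g * h)" "fps_nth h 0 \<noteq> 0"
  shows "fps_agree m f g"
proof -
  have "fps_agree m (f * h * inverse h) (g * h * inverse h)"
    by (intro fps_agree_mult assms) simp
  then show ?thesis
    using assms(2) by (simp add: mult.assoc inverse_mult_eq_1')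
qed

lemma qpoch_nth_0 [simp]:
  fixes x :: "'a::field fps"
  shows "fps_nth x 0 = 0 \<Longrightarrow> fps_nth (qpoch x Q n) 0 = 1"
  by (induction n) (simp_all add: qpoch_Suc)

text \<open>\<open>Q\<close> has no constant term, so every factor of index at least
  \<open>m\<close> is 1 modulo \<open>fps_X ^ m\<close>.\<close>

lemma qpoch_agree_add:
  fixes x :: "'a::field fps"
  assumes "fps_nth Q 0 = 0"
  shows "fps_agree m (qpoch x Q (m + k)) (qpoch x Q m)"
proof (induction k)
  case (Suc k)
  have "fps_nth (x * Q ^ (m + k)) i = 0" if "i < m" for i
    using startsby_zero_power_prefix[of Q] assms that by (simp add: fps_mult_nth)
  then have "fps_agree m (1 - x * Q ^ (m + k)) 1"
    by (simp add: fps_agree_def)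
  then have "fps_agree m (qpoch x Q (m + k) * (1 - x * Q ^ (m + k))) (qpoch x Q m * 1)"
    by (rule fps_agree_mult[OF Suc])
  then show ?case
    by (simp add: qpoch_Suc)
qed simp

lemma qpoch_agree:
  fixes x :: "'a::field fps"
  assumes "fps_nth Q 0 = 0" "m \<le> a" "m \<le> b"
  shows "fps_agree m (qpoch x Q a) (qpoch x Q b)"
  using qpoch_agree_add[OF assms(1), of m x "a - m"] qpoch_agree_add[OF assms(1), of m x "b - m"] assms
  by (auto intro: fps_agree_trans fps_agree_sym)

abbreviation inv_qpoch :: "'a::field fps \<Rightarrow> nat \<Rightarrow> 'a fps" where
  "inv_qpoch Q n \<equiv> inverse (qpoch Q Q n)"

lemma inv_qpoch_mult:
  "fps_nth Q 0 = 0 \<Longrightarrow> inv_qpoch Q n * qpoch Q Q n = 1"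
  by (simp add: inverse_mult_eq_1)

lemma inv_qpoch_agree:
  assumes "fps_nth Q 0 = 0" "m \<le> a" "m \<le> b"
  shows "fps_agree m (inv_qpoch Q a) (inv_qpoch Q b)"
  using assms by (intro fps_agree_inverse qpoch_agree) simp_all

text \<open>Replacing \<open>L - n\<close> by \<open>L\<close> only changes coefficients from \<open>L - n\<close> on, and the factor
  \<open>fps_X ^ k\<close> pushes these beyond \<open>L\<close>.\<close>

lemma inv_qpoch_agree_X_power:
  assumes "fps_nth Q 0 = 0" "n \<le> k"
  shows "fps_agree L (fps_X ^ k * inv_qpoch Q (L - n)) (fps_X ^ k * inv_qpoch Q L)"
  using assms by (intro fps_agree_X_power inv_qpoch_agree) auto

section \<open>The Slater-type identity\<close>

definition slater_term :: "nat \<Rightarrow> rat fps" where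
  "slater_term n = fps_X ^ (n * n + 2 * n) * qpoch (- fps_X) (fps_X ^ 2) n * inv_qpoch (fps_X ^ 4) n"

text \<open>The terms of index r and -r-1 of the two-sided theta series with summand (-1)^k X^(3k^2
  + 2k), taken together.\<close>

definition theta_term :: "nat \<Rightarrow> rat fps" where
  "theta_term r = (- 1) ^ r * fps_X ^ (3 * r * r + 2 * r) * (1 - fps_X ^ (2 * r + 1))"

text \<open>The power of X in \<open>theta_term r\<close> has exponent at least \<open>r\<close>,
  which makes up for replacing L - r by L.\<close>

lemma theta_term_inv_qpoch_agree:
  assumes "fps_nth Q 0 = 0"
  shows "fps_agree L (\<Sum>r\<le>L. theta_term r * inv_qpoch Q (L - r) * inv_qpoch Q (L + r + 1))
    ((\<Sum>r\<le>L. theta_term r) * inv_qpoch Q L * inv_qpoch Q L)"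
proof -
  have "fps_agree L (theta_term r * inv_qpoch Q (L - r) * inv_qpoch Q (L + r + 1))
      (theta_term r * inv_qpoch Q L * inv_qpoch Q L)" for r
  proof (rule fps_agree_mult)
    show "fps_agree L (theta_term r * inv_qpoch Q (L - r)) (theta_term r * inv_qpoch Q L)"
      using fps_agree_mult[OF fps_agree_refl[of L "(- 1) ^ r * (1 - fps_X ^ (2 * r + 1))"]
          inv_qpoch_agree_X_power[OF assms, of r "3 * r * r + 2 * r" L]]
      by (simp add: theta_term_def mult_ac)
    show "fps_agree L (inv_qpoch Q (L + r + 1)) (inv_qpoch Q L)"
      using assms by (rule inv_qpoch_agree) simp_all
  qed
  then show ?thesis
    unfolding sum_distrib_right by (intro fps_agree_sum)
qed

text \<open>Modulo X^L all inverse factorials in \<open>slater_finite\<close> may be given length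
  \<open>L\<close>. One remains on the left and two on the right, so one cancels.\<close>

lemma slater_sum_agree:
  "fps_agree L (\<Sum>n\<le>L. slater_term n)
    (qpoch (- fps_X) (fps_X ^ 2) (L + 1) * (\<Sum>r\<le>L. theta_term r) * inv_qpoch (fps_X ^ 2) L)"
proof -
  let ?iq = "inv_qpoch (fps_X ^ 2 :: rat fps)"
  have Q0: "fps_nth (fps_X ^ 2 :: rat fps) 0 = 0" by simp
  have "fps_agree L (slater_term n * ?iq L) (slater_term n * ?iq (L - n))" for n
    using fps_agree_mult[OF fps_agree_refl[of L "qpoch (- fps_X) (fps_X ^ 2) n * inv_qpoch (fps_X ^ 4) n"]
        fps_agree_sym[OF inv_qpoch_agree_X_power[OF Q0, of n "n * n + 2 * n" L]]]
    by (simp add: slater_term_def mult_ac)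
  then have "fps_agree L ((\<Sum>n\<le>L. slater_term n) * ?iq L) (\<Sum>n\<le>L. slater_term n * ?iq (L - n))"
    unfolding sum_distrib_right by (intro fps_agree_sum)
  also have "(\<Sum>n\<le>L. slater_term n * ?iq (L - n)) = qpoch (- fps_X) (fps_X ^ 2) (L + 1)
      * (\<Sum>r\<le>L. theta_term r * ?iq (L - r) * ?iq (L + r + 1))"
    unfolding slater_term_def theta_term_def
    by (rule slater_finite) (simp_all add: inv_qpoch_mult)
  also have "fps_agree L \<dots> (qpoch (- fps_X) (fps_X ^ 2) (L + 1)
      * ((\<Sum>r\<le>L. theta_term r) * ?iq L * ?iq L))"
    by (intro fps_agree_mult theta_term_inv_qpoch_agree) simp_all
  finally have "fps_agree L ((\<Sum>n\<le>L. slater_term n) * ?iq L)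
      ((qpoch (- fps_X) (fps_X ^ 2) (L + 1) * (\<Sum>r\<le>L. theta_term r) * ?iq L) * ?iq L)"
    by (simp add: mult.assoc)
  then show ?thesis
    by (rule fps_agree_cancel) simp
qed

text \<open>The finite triple product with base X^6, z = X and w = X^5.\<close>

lemma theta_sum_agree:
  "fps_agree L (\<Sum>r\<le>L. theta_term r)
    (qpoch fps_X (fps_X ^ 6) (L + 1) * qpoch (fps_X ^ 5) (fps_X ^ 6) L * qpoch (fps_X ^ 6) (fps_X ^ 6) L)"
proof -
  let ?Q = "fps_X ^ 6 :: rat fps"
  let ?P = "qpoch fps_X ?Q (L + 1) * qpoch (fps_X ^ 5) ?Q L"
  have inv: "inv_qpoch ?Q n * qpoch ?Q ?Q n = 1" for n
    by (simp add: inv_qpoch_mult)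
  have theta: "theta_term r = (- 1) ^ r * ((fps_X ^ 5) ^ r * ?Q ^ (r choose 2)
      - fps_X ^ (r + 1) * ?Q ^ (Suc r choose 2))" for r
  proof -
    have "3 * r * r + 2 * r = 5 * r + 6 * (r choose 2)"
      using double_choose_two[of r] by simp
    moreover have "3 * r * r + 2 * r + (2 * r + 1) = r + 1 + 6 * (Suc r choose 2)"
      using double_choose_two[of r] by (simp add: Suc_choose_two)
    ultimately have
      "(fps_X :: rat fps) ^ (3 * r * r + 2 * r) = fps_X ^ (5 * r + 6 * (r choose 2))"
      "(fps_X :: rat fps) ^ (3 * r * r + 2 * r) * fps_X ^ (2 * r + 1) = fps_X ^ (r + 1 + 6 * (Suc r choose 2))"
      by (simp_all only: flip: power_add)
    then have
      "(fps_X :: rat fps) ^ (3 * r * r + 2 * r) = (fps_X ^ 5) ^ r * ?Q ^ (r choose 2)"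
      "(fps_X :: rat fps) ^ (3 * r * r + 2 * r) * fps_X ^ (2 * r + 1) = fps_X ^ (r + 1) * ?Q ^ (Suc r choose 2)"
      unfolding power_add[of fps_X "5 * r"] power_add[of fps_X "r + 1"] by (simp_all only: power_mult)
    then show ?thesis
      unfolding theta_term_def by (simp only: right_diff_distrib mult.assoc mult_1_right)
  qed
  have "fps_agree L ((\<Sum>r\<le>L. theta_term r) * inv_qpoch ?Q L * inv_qpoch ?Q L)
      (\<Sum>r\<le>L. theta_term r * inv_qpoch ?Q (L - r) * inv_qpoch ?Q (L + r + 1))"
    by (intro fps_agree_sym[OF theta_term_inv_qpoch_agree]) simp
  also have "\<dots> = inv_qpoch ?Q (2 * L + 1) * qpoch fps_X ?Q (L + 1) * qpoch (fps_X ^ 5) ?Q L"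
    unfolding theta by (rule finite_jacobi_triple_product[of "inv_qpoch ?Q", OF inv]) (simp_all flip: power_Suc)
  also have "fps_agree L \<dots> (inv_qpoch ?Q L * qpoch fps_X ?Q (L + 1) * qpoch (fps_X ^ 5) ?Q L)"
    by (intro fps_agree_mult inv_qpoch_agree) simp_all
  also have "\<dots> = ?P * inv_qpoch ?Q L"
    by (simp add: mult_ac)
  finally have "fps_agree L ((\<Sum>r\<le>L. theta_term r) * inv_qpoch ?Q L) ?P"
    by (rule fps_agree_cancel) simp
  also have "?P = ?P * qpoch ?Q ?Q L * inv_qpoch ?Q L"
    using inv[of L] by (simp add: mult.assoc mult.commute[of "qpoch ?Q ?Q L"])
  finally show ?thesis
    by (rule fps_agree_cancel) simp
qed

text \<open>The lengths are chosen so that the identity is exact. Raising \<open>K\<close> by one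
  adds finitely many factors on each side, and they match through 1 - q^2 u^2 = (1 - q u)(1 + q u)
  and 1 - q^10 u^2 = (1 - q^5 u)(1 + q^5 u) with u = q^(6K).\<close>

lemma product_rearrangement:
  fixes q :: "'a::comm_ring_1"
  shows "qpoch (- q) (q ^ 2) (3 * K) * qpoch q (q ^ 6) K * qpoch (q ^ 5) (q ^ 6) K * qpoch (q ^ 6) (q ^ 6) (2 * K)
      * (qpoch (q ^ 4) (q ^ 12) K * qpoch (q ^ 8) (q ^ 12) K)
    = qpoch (- (q ^ 3)) (q ^ 6) K * qpoch (q ^ 2) (q ^ 2) (6 * K)"
proof (induction K)
  case 0
  show ?case by simp
next
  case (Suc K)
  define u where "u = q ^ (6 * K)"
  have u: "(q ^ 2) ^ (3 * K) = u" "(q ^ 6) ^ K = u" "(q ^ 6) ^ (2 * K) = u * u"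
      "(q ^ 12) ^ K = u * u" "(q ^ 2) ^ (6 * K) = u * u"
    by (simp_all add: u_def flip: power_mult power_add)
  have sq: "1 - q ^ 2 * (u * u) = (1 - q * u) * (1 + q * u)"
      "1 - q ^ 10 * (u * u) = (1 - q ^ 5 * u) * (1 + q ^ 5 * u)"
    by (simp_all add: algebra_simps flip: power_add power_Suc) (simp_all add: power2_eq_square)
  have a: "qpoch (- q) (q ^ 2) (3 * Suc K)
      = qpoch (- q) (q ^ 2) (3 * K) * ((1 + q * u) * (1 + q ^ 3 * u) * (1 + q ^ 5 * u))"
  proof -
    have "3 * Suc K = Suc (Suc (Suc (3 * K)))" by simp
    then show ?thesis
      by (simp only: qpoch_Suc power_Suc u) (simp add: mult_ac power2_eq_square power3_eq_cube power_numeral_reduce)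
  qed
  have b: "qpoch (q ^ 6) (q ^ 6) (2 * Suc K)
      = qpoch (q ^ 6) (q ^ 6) (2 * K) * ((1 - q ^ 6 * (u * u)) * (1 - q ^ 12 * (u * u)))"
  proof -
    have "2 * Suc K = Suc (Suc (2 * K))" by simp
    then show ?thesis
      by (simp only: qpoch_Suc power_Suc u) (simp add: mult_ac power_numeral_reduce)
  qed
  have c: "qpoch (q ^ 2) (q ^ 2) (6 * Suc K) = qpoch (q ^ 2) (q ^ 2) (6 * K)
      * ((1 - q ^ 2 * (u * u)) * (1 - q ^ 4 * (u * u)) * (1 - q ^ 6 * (u * u))
        * (1 - q ^ 8 * (u * u)) * (1 - q ^ 10 * (u * u)) * (1 - q ^ 12 * (u * u)))"
  proof -
    have "6 * Suc K = Suc (Suc (Suc (Suc (Suc (Suc (6 * K))))))" by simp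
    then show ?thesis
      by (simp only: qpoch_Suc power_Suc u) (simp add: mult_ac power_numeral_reduce)
  qed
  have d: "qpoch q (q ^ 6) (Suc K) = qpoch q (q ^ 6) K * (1 - q * u)"
      "qpoch (q ^ 5) (q ^ 6) (Suc K) = qpoch (q ^ 5) (q ^ 6) K * (1 - q ^ 5 * u)"
      "qpoch (q ^ 4) (q ^ 12) (Suc K) = qpoch (q ^ 4) (q ^ 12) K * (1 - q ^ 4 * (u * u))"
      "qpoch (q ^ 8) (q ^ 12) (Suc K) = qpoch (q ^ 8) (q ^ 12) K * (1 - q ^ 8 * (u * u))"
      "qpoch (- (q ^ 3)) (q ^ 6) (Suc K) = qpoch (- (q ^ 3)) (q ^ 6) K * (1 + q ^ 3 * u)"
    by (simp_all add: qpoch_Suc u)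
  let ?w = "(1 + q * u) * (1 + q ^ 3 * u) * (1 + q ^ 5 * u) * ((1 - q ^ 6 * (u * u)) * (1 - q ^ 12 * (u * u)))
      * (1 - q * u) * (1 - q ^ 5 * u) * (1 - q ^ 4 * (u * u)) * (1 - q ^ 8 * (u * u))"
  have "qpoch (- q) (q ^ 2) (3 * Suc K) * qpoch q (q ^ 6) (Suc K) * qpoch (q ^ 5) (q ^ 6) (Suc K)
      * qpoch (q ^ 6) (q ^ 6) (2 * Suc K) * (qpoch (q ^ 4) (q ^ 12) (Suc K) * qpoch (q ^ 8) (q ^ 12) (Suc K))
    = (qpoch (- q) (q ^ 2) (3 * K) * qpoch q (q ^ 6) K * qpoch (q ^ 5) (q ^ 6) K * qpoch (q ^ 6) (q ^ 6) (2 * K)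
      * (qpoch (q ^ 4) (q ^ 12) K * qpoch (q ^ 8) (q ^ 12) K)) * ?w"
    unfolding a b d by (simp only: mult_ac)
  also have "\<dots> = qpoch (- (q ^ 3)) (q ^ 6) (Suc K) * qpoch (q ^ 2) (q ^ 2) (6 * Suc K)"
    unfolding Suc.IH c d sq by (simp only: mult_ac)
  finally show ?case .
qed

text \<open>All lengths in \<open>product_rearrangement\<close> at K = m are at least
  \<open>m\<close>, so modulo X^m the products from the Slater and theta sums may be brought to
  these lengths.\<close>

lemma slater_sum_eq_product:
  "fps_agree m (\<Sum>n\<le>m. slater_term n)
    (qpoch (- (fps_X ^ 3)) (fps_X ^ 6) m
      * inverse (qpoch (fps_X ^ 4) (fps_X ^ 12) m * qpoch (fps_X ^ 8) (fps_X ^ 12) m))"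
proof -
  let ?X = "fps_X :: rat fps"
  let ?A = "qpoch (- ?X) (?X ^ 2) (3 * m) * qpoch ?X (?X ^ 6) m * qpoch (?X ^ 5) (?X ^ 6) m
      * qpoch (?X ^ 6) (?X ^ 6) (2 * m)"
  let ?B = "qpoch (?X ^ 4) (?X ^ 12) m * qpoch (?X ^ 8) (?X ^ 12) m"
  have "fps_agree m (\<Sum>n\<le>m. slater_term n)
      (qpoch (- ?X) (?X ^ 2) (m + 1) * (\<Sum>r\<le>m. theta_term r) * inv_qpoch (?X ^ 2) m)"
    by (rule slater_sum_agree)
  also have "fps_agree m \<dots> (qpoch (- ?X) (?X ^ 2) (3 * m)
      * (qpoch ?X (?X ^ 6) m * qpoch (?X ^ 5) (?X ^ 6) m * qpoch (?X ^ 6) (?X ^ 6) (2 * m))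
      * inv_qpoch (?X ^ 2) (6 * m))"
  proof (intro fps_agree_mult inv_qpoch_agree)
    show "fps_agree m (qpoch (- ?X) (?X ^ 2) (m + 1)) (qpoch (- ?X) (?X ^ 2) (3 * m))"
    proof (cases "m = 0")
      case True
      then show ?thesis by (simp add: fps_agree_def)
    qed (intro qpoch_agree; simp)
    have "fps_agree m (\<Sum>r\<le>m. theta_term r)
        (qpoch ?X (?X ^ 6) (m + 1) * qpoch (?X ^ 5) (?X ^ 6) m * qpoch (?X ^ 6) (?X ^ 6) m)"
      by (rule theta_sum_agree)
    also have "fps_agree m \<dots> (qpoch ?X (?X ^ 6) m * qpoch (?X ^ 5) (?X ^ 6) m * qpoch (?X ^ 6) (?X ^ 6) (2 * m))"
      by (intro fps_agree_mult qpoch_agree) simp_all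
    finally show "fps_agree m (\<Sum>r\<le>m. theta_term r)
        (qpoch ?X (?X ^ 6) m * qpoch (?X ^ 5) (?X ^ 6) m * qpoch (?X ^ 6) (?X ^ 6) (2 * m))" .
  qed simp_all
  also have "\<dots> = ?A * inv_qpoch (?X ^ 2) (6 * m)"
    by (simp only: mult_ac)
  also have "\<dots> = qpoch (- (?X ^ 3)) (?X ^ 6) m * inverse ?B"
  proof -
    have B: "?B * inverse ?B = 1"
      by (rule inverse_mult_eq_1') simp
    have "?A = (?A * ?B) * inverse ?B"
      by (subst mult.assoc[of ?A ?B]) (simp only: B mult_1_right)
    then have "?A * inv_qpoch (?X ^ 2) (6 * m) = (?A * ?B) * inverse ?B * inv_qpoch (?X ^ 2) (6 * m)"
      by (simp only:)
    also have "\<dots> = qpoch (- (?X ^ 3)) (?X ^ 6) m * inverse ?B * (inv_qpoch (?X ^ 2) (6 * m) * qpoch (?X ^ 2) (?X ^ 2) (6 * m))"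
      unfolding product_rearrangement by (simp only: mult_ac)
    finally show ?thesis
      by (simp add: inv_qpoch_mult)
  qed
  finally show ?thesis .
qed

section \<open>The generating function of \<open>P\<close>\<close>

text \<open>\<open>A\<close> holds the admissible parts and \<open>D\<close> those that may not be
  repeated. Keeping \<open>A\<close> general allows the generating function to be built one part
  size at a time.\<close>

definition restricted_partitions :: "nat set \<Rightarrow> nat set \<Rightarrow> nat \<Rightarrow> nat multiset set" where
  "restricted_partitions A D N =
    {M. set_mset M \<subseteq> A \<and> (\<forall>b \<in># M. b \<in> D \<longrightarrow> count M b = 1) \<and> sum_mset M = N}"

lemma finite_restricted_partitions: "0 \<notin> A \<Longrightarrow> finite (restricted_partitions A D N)"
  by (rule finite_subset[OF _ finite_partitions_of[of N]])
    (auto simp: restricted_partitions_def partitions_of_def intro!: gr0I)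

lemma restricted_partitions_insert_distinct:
  assumes "b \<notin> A" "b \<in> D"
  shows "restricted_partitions (insert b A) D N = restricted_partitions A D N
    \<union> (if b \<le> N then add_mset b ` restricted_partitions A D (N - b) else {})"
proof (intro equalityI subsetI)
  fix M assume M: "M \<in> restricted_partitions (insert b A) D N"
  show "M \<in> restricted_partitions A D N
      \<union> (if b \<le> N then add_mset b ` restricted_partitions A D (N - b) else {})"
  proof (cases "b \<in># M")
    case True
    then obtain M' where M': "M = add_mset b M'"
      by (metis mset_add)
    then have b: "b \<notin># M'"
      using M \<open>b \<in> D\<close> by (auto simp: restricted_partitions_def not_in_iff)
    have "count M' c = 1" if "c \<in># M'" "c \<in> D" for c
      using M that b by (auto simp: restricted_partitions_def M' split: if_splits)
    then have "M' \<in> restricted_partitions A D (N - b)" "b \<le> N"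
      using M b by (auto simp: restricted_partitions_def M')
    then show ?thesis
      using M' by auto
  qed (use M in \<open>auto simp: restricted_partitions_def\<close>)
next
  fix M assume "M \<in> restricted_partitions A D N
      \<union> (if b \<le> N then add_mset b ` restricted_partitions A D (N - b) else {})"
  then show "M \<in> restricted_partitions (insert b A) D N"
    using \<open>b \<notin> A\<close> by (auto simp: restricted_partitions_def count_eq_zero_iff split: if_splits)
qed

text \<open>Removing one copy of \<open>b\<close> may leave others, so the second set again admits
  \<open>b\<close>. This self-reference produces the geometric series factor.\<close>

lemma restricted_partitions_insert_repeatable:
  assumes "b \<notin> A" "b \<notin> D"
  shows "restricted_partitions (insert b A) D N = restricted_partitions A D N
    \<union> (if b \<le> N then add_mset b ` restricted_partitions (insert b A) D (N - b) else {})"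
proof (intro equalityI subsetI)
  fix M assume M: "M \<in> restricted_partitions (insert b A) D N"
  show "M \<in> restricted_partitions A D N
      \<union> (if b \<le> N then add_mset b ` restricted_partitions (insert b A) D (N - b) else {})"
  proof (cases "b \<in># M")
    case True
    then obtain M' where M': "M = add_mset b M'"
      by (metis mset_add)
    have "count M' c = 1" if "c \<in># M'" "c \<in> D" for c
      using M that \<open>b \<notin> D\<close> by (auto simp: restricted_partitions_def M' split: if_splits)
    then have "M' \<in> restricted_partitions (insert b A) D (N - b)" "b \<le> N"
      using M by (auto simp: restricted_partitions_def M')
    then show ?thesis
      using M' by auto
  qed (use M in \<open>auto simp: restricted_partitions_def\<close>)
next
  fix M assume "M \<in> restricted_partitions A D N
      \<union> (if b \<le> N then add_mset b ` restricted_partitions (insert b A) D (N - b) else {})"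
  then show "M \<in> restricted_partitions (insert b A) D N"
    using \<open>b \<notin> D\<close> by (auto simp: restricted_partitions_def split: if_splits)
qed

lemma restricted_partitions_gf:
  assumes "finite A" "0 \<notin> A"
  shows "Abs_fps (\<lambda>N. of_nat (card (restricted_partitions A D N)) :: rat)
    = (\<Prod>b\<in>A. if b \<in> D then 1 + fps_X ^ b else inverse (1 - fps_X ^ b))"
  using assms
proof (induction A rule: finite_induct)
  case empty
  have "restricted_partitions {} D N = (if N = 0 then {{#}} else {})" for N
    by (auto simp: restricted_partitions_def)
  then show ?case
    by (auto simp: fps_eq_iff)
next
  case (insert b A)
  define f where "f A = Abs_fps (\<lambda>N. of_nat (card (restricted_partitions A D N)) :: rat)" for A
  have b: "b > 0" and A0: "0 \<notin> A" "0 \<notin> insert b A"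
    using insert.prems by auto
  have not_part: "add_mset b M \<notin> restricted_partitions A D N" for M N
    using insert.hyps(2) by (simp add: restricted_partitions_def)
  have f: "f (insert b A) = f A * (if b \<in> D then 1 + fps_X ^ b else inverse (1 - fps_X ^ b))"
  proof (cases "b \<in> D")
    case True
    have "fps_nth (f (insert b A)) N = fps_nth (f A + fps_X ^ b * f A) N" for N
    proof -
      have "restricted_partitions A D N \<inter> add_mset b ` restricted_partitions A D (N - b) = {}"
        using not_part by auto
      then have "card (restricted_partitions (insert b A) D N) = card (restricted_partitions A D N)
          + (if b \<le> N then card (restricted_partitions A D (N - b)) else 0)"
        using finite_restricted_partitions[OF A0(1)]
        by (subst restricted_partitions_insert_distinct[OF insert.hyps(2) True])
          (auto simp: card_Un_disjoint card_image inj_on_def)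
      then show ?thesis
        by (simp add: f_def fps_X_power_mult_nth)
    qed
    then have "f (insert b A) = f A + fps_X ^ b * f A"
      by (simp add: fps_eq_iff)
    then show ?thesis
      using True by (simp add: algebra_simps)
  next
    case False
    have "fps_nth (f (insert b A)) N = fps_nth (f A + fps_X ^ b * f (insert b A)) N" for N
    proof -
      have "restricted_partitions A D N \<inter> add_mset b ` restricted_partitions (insert b A) D (N - b) = {}"
        using not_part by auto
      then have "card (restricted_partitions (insert b A) D N) = card (restricted_partitions A D N)
          + (if b \<le> N then card (restricted_partitions (insert b A) D (N - b)) else 0)"
        using finite_restricted_partitions[OF A0(1)] finite_restricted_partitions[OF A0(2)]
        by (subst restricted_partitions_insert_repeatable[OF insert.hyps(2) False])
          (auto simp: card_Un_disjoint card_image inj_on_def)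
      then show ?thesis
        by (simp add: f_def fps_X_power_mult_nth)
    qed
    then have "f (insert b A) = f A + fps_X ^ b * f (insert b A)"
      by (simp add: fps_eq_iff)
    then have *: "f (insert b A) * (1 - fps_X ^ b) = f A"
      by (simp add: algebra_simps)
    have "(1 - fps_X ^ b) * inverse (1 - fps_X ^ b) = (1 :: rat fps)"
      using b by (intro inverse_mult_eq_1') simp
    then have "f (insert b A) = f (insert b A) * (1 - fps_X ^ b) * inverse (1 - fps_X ^ b)"
      by (simp add: mult.assoc)
    then show ?thesis
      unfolding * using False by simp
  qed
  show ?case
    using f insert.IH[OF A0(1)] insert.hyps
    by (simp add: mult.commute f_def)
qed

text \<open>The residues 3, 4, 8, 9 are \<plusminus>3 and \<plusminus>4 modulo 12. The bound keeps
  the set finite and made of \<open>m\<close> whole blocks of 12.\<close>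

definition P_parts :: "nat \<Rightarrow> nat set" where
  "P_parts m = {b. b < 12 * m \<and> b mod 12 \<in> {3, 4, 8, 9}}"

lemma P_parts_Suc:
  "P_parts (Suc m) = {12 * m + 3, 12 * m + 4, 12 * m + 8, 12 * m + 9} \<union> P_parts m"
proof (rule set_eqI)
  fix b :: nat
  have lt: "b < 12 * k \<longleftrightarrow> b div 12 < k" for k
    by (simp add: div_less_iff_less_mult mult.commute)
  have iff: "b div 12 = m \<and> b mod 12 = c \<longleftrightarrow> b = 12 * m + c" if "c < 12" for c
    using that mult_div_mod_eq[of 12 b] by auto
  have "b \<in> P_parts (Suc m) \<longleftrightarrow> b div 12 = m \<and> b mod 12 \<in> {3, 4, 8, 9} \<or> b \<in> P_parts m"
    by (auto simp: P_parts_def lt less_Suc_eq)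
  also have "b div 12 = m \<and> b mod 12 \<in> {3, 4, 8, 9} \<longleftrightarrow> b \<in> {12 * m + 3, 12 * m + 4, 12 * m + 8, 12 * m + 9}"
    using iff[of 3] iff[of 4] iff[of 8] iff[of 9] by auto
  finally show "b \<in> P_parts (Suc m) \<longleftrightarrow> b \<in> {12 * m + 3, 12 * m + 4, 12 * m + 8, 12 * m + 9} \<union> P_parts m"
    by simp
qed

text \<open>A block of 12 contributes two factors with exponents 3 modulo 6, hence the length
  \<open>2 * m\<close>, and one factor for each of the residues 4 and 8.\<close>

lemma P_parts_product:
  "(\<Prod>b\<in>P_parts m. if b \<in> {b. b mod 6 = 3} then 1 + fps_X ^ b else inverse (1 - fps_X ^ b))
    = qpoch (- (fps_X ^ 3)) (fps_X ^ 6) (2 * m)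
      * inverse (qpoch (fps_X ^ 4) (fps_X ^ 12) m * qpoch (fps_X ^ 8) (fps_X ^ 12) m :: rat fps)"
proof (induction m)
  case 0
  show ?case by (simp add: P_parts_def)
next
  case (Suc m)
  let ?g = "\<lambda>b. if b \<in> {b. b mod 6 = 3} then 1 + fps_X ^ b else inverse (1 - fps_X ^ b :: rat fps)"
  have fin: "finite (P_parts m)"
    by (rule finite_subset[of _ "{..<12 * m}"]) (auto simp: P_parts_def)
  have mod6: "(12 * m + c) mod 6 = c mod 6" for c
  proof -
    have "12 * m + c = c + (2 * m) * 6"
      by simp
    then show ?thesis
      by (simp only: mod_mult_self1)
  qed
  have "(\<Prod>b\<in>P_parts (Suc m). ?g b)
      = (\<Prod>b\<in>{12 * m + 3, 12 * m + 4, 12 * m + 8, 12 * m + 9}. ?g b) * (\<Prod>b\<in>P_parts m. ?g b)"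
    unfolding P_parts_Suc using fin by (intro prod.union_disjoint) (auto simp: P_parts_def)
  also have "(\<Prod>b\<in>{12 * m + 3, 12 * m + 4, 12 * m + 8, 12 * m + 9}. ?g b)
      = ?g (12 * m + 3) * (?g (12 * m + 4) * (?g (12 * m + 8) * ?g (12 * m + 9)))"
    by simp
  also have "?g (12 * m + 3) = 1 + fps_X ^ (12 * m + 3)"
    using mod6 by simp
  also have "?g (12 * m + 9) = 1 + fps_X ^ (12 * m + 9)"
    using mod6 by simp
  also have "?g (12 * m + 4) = inverse (1 - fps_X ^ (12 * m + 4))"
    using mod6 by simp
  also have "?g (12 * m + 8) = inverse (1 - fps_X ^ (12 * m + 8))"
    using mod6 by simp
  finally have g: "(\<Prod>b\<in>P_parts (Suc m). ?g b) = (1 + fps_X ^ (12 * m + 3)) * (inverse (1 - fps_X ^ (12 * m + 4))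
      * (inverse (1 - fps_X ^ (12 * m + 8)) * (1 + fps_X ^ (12 * m + 9)))) * (\<Prod>b\<in>P_parts m. ?g b)" .
  have "2 * Suc m = Suc (Suc (2 * m))" by simp
  then have a: "qpoch (- (fps_X ^ 3)) (fps_X ^ 6) (2 * Suc m) = qpoch (- (fps_X ^ 3)) (fps_X ^ 6) (2 * m)
      * ((1 + fps_X ^ (12 * m + 3)) * (1 + fps_X ^ (12 * m + 9)) :: rat fps)"
    by (simp only: qpoch_Suc) (simp add: mult.assoc add.commute flip: power_mult power_add)
  have b: "qpoch (fps_X ^ 4) (fps_X ^ 12) (Suc m)
        = qpoch (fps_X ^ 4) (fps_X ^ 12) m * (1 - fps_X ^ (12 * m + 4) :: rat fps)"
      "qpoch (fps_X ^ 8) (fps_X ^ 12) (Suc m)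
        = qpoch (fps_X ^ 8) (fps_X ^ 12) m * (1 - fps_X ^ (12 * m + 8) :: rat fps)"
    by (simp_all add: qpoch_Suc add.commute flip: power_mult power_add)
  show ?case
    unfolding g Suc.IH a b by (simp only: fps_inverse_mult mult_ac)
qed

text \<open>No part of a partition of \<open>N\<close> exceeds \<open>N\<close>, so the bound in
  \<open>P_parts\<close> excludes nothing.\<close>

lemma P_partitions_eq:
  assumes "N < 12 * m"
  shows "P_partitions N = restricted_partitions (P_parts m) {b. b mod 6 = 3} N"
proof -
  have allowed: "([int b = 3] (mod 12) \<or> [int b = - 3] (mod 12) \<or> [int b = 4] (mod 12) \<or> [int b = - 4] (mod 12))
      \<longleftrightarrow> b mod 12 \<in> {3, 4, 8, 9}" for b
  proof -
    have "int b mod 12 = int (b mod 12)"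
      by (simp add: zmod_int)
    then show ?thesis
      by (auto simp: cong_def)
  qed
  have cong3: "[b = 3] (mod 6) \<longleftrightarrow> b mod 6 = 3" for b :: nat
    by (simp add: cong_def)
  have parts: "(\<forall>b\<in>#p. 0 < b) \<and> (\<forall>b\<in>#p. b mod 12 \<in> {3, 4, 8, 9}) \<longleftrightarrow> set_mset p \<subseteq> P_parts m"
    if "sum_mset p = N" for p
  proof -
    have "b < 12 * m" if "b \<in># p" for b
      using multi_member_split[OF that] \<open>sum_mset p = N\<close> assms by auto
    moreover have "0 < b" if "b mod 12 \<in> {3, 4, 8, 9}" for b :: nat
      using that by (intro gr0I) auto
    ultimately show ?thesis
      unfolding P_parts_def by blast
  qed
  show ?thesis
    unfolding P_partitions_def partitions_of_def restricted_partitions_def allowed cong3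
    using parts by blast
qed

lemma count_P_eq_coeff:
  assumes "N < m"
  shows "of_nat (count_P N) = fps_nth (qpoch (- (fps_X ^ 3)) (fps_X ^ 6) m
      * inverse (qpoch (fps_X ^ 4) (fps_X ^ 12) m * qpoch (fps_X ^ 8) (fps_X ^ 12) m) :: rat fps) N"
proof -
  have "finite (P_parts m)" "0 \<notin> P_parts m"
    by (rule finite_subset[of _ "{..<12 * m}"]) (auto simp: P_parts_def)
  then have gf: "Abs_fps (\<lambda>N. of_nat (card (restricted_partitions (P_parts m) {b. b mod 6 = 3} N)))
      = qpoch (- (fps_X ^ 3)) (fps_X ^ 6) (2 * m)
        * inverse (qpoch (fps_X ^ 4) (fps_X ^ 12) m * qpoch (fps_X ^ 8) (fps_X ^ 12) m :: rat fps)"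
    unfolding P_parts_product[symmetric] by (rule restricted_partitions_gf)
  have "of_nat (count_P N)
      = fps_nth (Abs_fps (\<lambda>N. of_nat (card (restricted_partitions (P_parts m) {b. b mod 6 = 3} N)) :: rat)) N"
    using assms by (simp add: count_P_def P_partitions_eq[of N m])
  moreover have "fps_agree m (qpoch (- (fps_X ^ 3)) (fps_X ^ 6) (2 * m)
        * inverse (qpoch (fps_X ^ 4) (fps_X ^ 12) m * qpoch (fps_X ^ 8) (fps_X ^ 12) m))
      (qpoch (- (fps_X ^ 3)) (fps_X ^ 6) m
        * inverse (qpoch (fps_X ^ 4) (fps_X ^ 12) m * qpoch (fps_X ^ 8) (fps_X ^ 12) m) :: rat fps)"
    by (intro fps_agree_mult qpoch_agree fps_agree_refl) simp_all
  ultimately show ?thesis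
    using assms unfolding gf by (simp add: fps_agree_def)
qed

section \<open>The generating function of \<open>G\<close>\<close>

text \<open>The residue conditions say that the part following \<open>p\<close> exceeds \<open>p\<close> by a minimal gap
  plus a multiple of 4; the smallest part is treated as the successor of an even part 0.\<close>

definition G_min_gap :: "nat \<Rightarrow> nat \<Rightarrow> nat" where
  "G_min_gap p x = (if even p \<noteq> even x then 3 else if even x then 4 else 2)"

definition G_step :: "nat \<Rightarrow> nat \<Rightarrow> bool" where
  "G_step p x \<longleftrightarrow> (\<exists>j. x = p + G_min_gap p x + 4 * j)"

text \<open>The minimal gap is at most 4, so p < x and the residue together already force x to be at
  least \<open>p\<close> plus the minimal gap.\<close>

lemma G_step_iff_mod: "G_step p x \<longleftrightarrow> p < x \<and> x mod 4 = (p + G_min_gap p x) mod 4"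
proof -
  define g where "g = G_min_gap p x"
  have g: "0 < g" "g \<le> 4"
    by (simp_all add: g_def G_min_gap_def)
  have "\<exists>j. x = p + g + 4 * j" if "p < x" "x mod 4 = (p + g) mod 4"
  proof (cases "p + g \<le> x")
    case True
    then have "4 dvd x - (p + g)"
      using that(2) mod_eq_dvd_iff_nat[of "p + g" x 4] by simp
    then show ?thesis
      using True by (metis dvd_def le_add_diff_inverse)
  next
    case False
    then have "4 dvd p + g - x"
      using that(2) mod_eq_dvd_iff_nat[of x "p + g" 4] by simp
    then show ?thesis
      using False that(1) g by (auto dest: dvd_imp_le)
  qed
  moreover have "p < x \<and> x mod 4 = (p + g) mod 4" if "x = p + g + 4 * j" for j
    using that g by simp
  ultimately show ?thesis
    unfolding G_step_def g_def[symmetric] by blast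
qed

lemma G_step_shift: "G_step (p + 2) (x + 2) \<longleftrightarrow> G_step p x"
  by (simp add: G_step_def G_min_gap_def)

text \<open>From 3 the least successors are 5 and 6, and so they are from 2. Hence what follows a
  smallest part 3 is a shifted chain starting from 0.\<close>

lemma G_step_2_3: "G_step 3 x \<longleftrightarrow> G_step 2 x"
  by (simp add: G_step_def G_min_gap_def)

text \<open>From 0 one reaches 3 + 4j and 4 + 4j; the case j = 0 is split off, and the rest are the
  successors of 4.\<close>

lemma G_step_0: "G_step 0 x \<longleftrightarrow> x = 3 \<or> x = 4 \<or> G_step 4 x"
proof -
  have *: "(\<exists>j. x = c + 4 * j) \<longleftrightarrow> x = c \<or> (\<exists>j. x = 4 + c + 4 * j)" for c
  proof -
    have "(\<exists>j. x = c + 4 * j) \<longleftrightarrow> x = c + 4 * 0 \<or> (\<exists>j. x = c + 4 * Suc j)"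
      by (metis not0_implies_Suc)
    then show ?thesis by (simp add: add_ac)
  qed
  show ?thesis
    using *[of 3] *[of 4] by (auto simp: G_step_def G_min_gap_def)
qed

text \<open>With \<open>t\<close> = k + s for the part \<open>x\<close>, the preceding part has t -
  2 if it is even and t - 1 if it is odd. The hypothesis is its residue condition rewritten in terms
  of \<open>t\<close>.\<close>

lemma G_step_iff_residue:
  assumes "p mod 4 = (2 * t + (if even p then 2 else 3)) mod 4"
  shows "G_step p x \<longleftrightarrow> p < x \<and> x mod 4 = (2 * t + (if even x then 2 else 1)) mod 4"
proof -
  have "(p + G_min_gap p x) mod 4 = (2 * t + (if even p then 2 else 3) + G_min_gap p x) mod 4"
    using assms by (metis mod_add_left_eq)
  also have "\<dots> = (2 * t + (if even x then 2 else 1)) mod 4"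
  proof -
    have "(a + 4) mod 4 = a mod 4" for a :: nat by simp
    from this[of "2 * t + 1"] this[of "2 * t + 2"] show ?thesis
      by (simp add: G_min_gap_def del: mod_add_self2)
  qed
  finally show ?thesis
    by (simp add: G_step_iff_mod)
qed

lemma G_step_gap:
  assumes "G_step x y"
  shows "(y - x) mod 4 \<noteq> 1"
proof -
  obtain j where "y = x + G_min_gap x y + 4 * j"
    using assms unfolding G_step_def by blast
  then have "y - x = G_min_gap x y + 4 * j"
    by (metis add.assoc diff_add_inverse)
  then show ?thesis
    by (simp add: G_min_gap_def)
qed

text \<open>Parts are listed in increasing order and \<open>p\<close> acts as the part before the
  list: 0 for a whole partition, 2 or 4 for the rest once the smallest part is known.\<close>

fun G_chain :: "nat \<Rightarrow> nat list \<Rightarrow> bool" where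
  "G_chain p [] \<longleftrightarrow> True"
| "G_chain p (x # xs) \<longleftrightarrow> G_step p x \<and> G_chain x xs"

lemma G_step_less: "G_step p x \<Longrightarrow> p < x"
  by (simp add: G_step_iff_mod)

lemma G_chain_less: "G_chain p xs \<Longrightarrow> x \<in> set xs \<Longrightarrow> p < x"
  by (induction xs arbitrary: p) (auto dest: G_step_less less_trans)

lemma G_chain_shift: "G_chain (p + 2) (map (\<lambda>x. x + 2) xs) \<longleftrightarrow> G_chain p xs"
  by (induction xs arbitrary: p) (simp_all only: list.map G_chain.simps G_step_shift)

section \<open>Chains counted by length and sum\<close>

definition G_lists :: "nat \<Rightarrow> nat \<Rightarrow> nat \<Rightarrow> nat list set" where
  "G_lists p n N = {xs. G_chain p xs \<and> length xs = n \<and> sum_list xs = N}"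

lemma finite_G_lists: "finite (G_lists p n N)"
proof (rule finite_subset)
  show "G_lists p n N \<subseteq> {xs. set xs \<subseteq> {..N} \<and> length xs = n}"
    using member_le_sum_list by (auto simp: G_lists_def)
qed (simp add: finite_lists_length_eq)

text \<open>Subtracting 2 from each of the \<open>n\<close> parts preserves parity and gaps and
  lowers the sum by 2n.\<close>

lemma G_lists_shift:
  "G_lists (p + 2) n N = (if 2 * n \<le> N then map (\<lambda>x. x + 2) ` G_lists p n (N - 2 * n) else {})"
proof -
  have sum: "sum_list (map (\<lambda>x. x + 2) xs) = sum_list xs + 2 * length xs" for xs :: "nat list"
    by (induction xs) simp_all
  have *: "\<exists>ys. xs = map (\<lambda>x. x + 2) ys \<and> G_chain p ys" if "G_chain (p + 2) xs" for xs
  proof -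
    have "map (\<lambda>x. x + 2) (map (\<lambda>x. x - 2) xs) = xs"
    proof -
      \<comment> \<open>Every entry exceeds p + 2, so the subtraction does not truncate.\<close>
      have "x - 2 + 2 = x" if "x \<in> set xs" for x
        using G_chain_less[OF \<open>G_chain (p + 2) xs\<close> that] by linarith
      then show ?thesis
        by (simp add: map_idI del: add_2_eq_Suc')
    qed
    then show ?thesis
      using that G_chain_shift by metis
  qed
  show ?thesis
  proof (intro equalityI subsetI)
    fix xs assume xs: "xs \<in> G_lists (p + 2) n N"
    then obtain ys where ys: "xs = map (\<lambda>x. x + 2) ys" "G_chain p ys"
      using * by (auto simp: G_lists_def)
    then show "xs \<in> (if 2 * n \<le> N then map (\<lambda>x. x + 2) ` G_lists p n (N - 2 * n) else {})"
      using xs sum[of ys] by (auto simp: G_lists_def)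
  next
    fix xs assume "xs \<in> (if 2 * n \<le> N then map (\<lambda>x. x + 2) ` G_lists p n (N - 2 * n) else {})"
    then show "xs \<in> G_lists (p + 2) n N"
      using G_chain_shift sum by (auto simp: G_lists_def split: if_splits)
  qed
qed

definition G_gf :: "nat \<Rightarrow> nat \<Rightarrow> rat fps" where
  "G_gf p n = Abs_fps (\<lambda>N. of_nat (card (G_lists p n N)))"

lemma G_gf_shift: "G_gf (p + 2) n = fps_X ^ (2 * n) * G_gf p n"
proof -
  have "inj_on (map (\<lambda>x. x + 2)) (G_lists p n N)" for N
    by (intro inj_on_mapI inj_onI) simp
  then have "card (G_lists (p + 2) n N) = (if 2 * n \<le> N then card (G_lists p n (N - 2 * n)) else 0)" for N
    unfolding G_lists_shift by (simp add: card_image del: add_2_eq_Suc')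
  then show ?thesis
    by (simp add: fps_eq_iff G_gf_def fps_X_power_mult_nth del: add_2_eq_Suc')
qed

text \<open>The three sets correspond to smallest part 3, smallest part 4, and a larger smallest
  part.\<close>

lemma G_lists_0_Suc:
  "G_lists 0 (Suc n) N = (if 3 \<le> N then Cons 3 ` G_lists 2 n (N - 3) else {})
    \<union> (if 4 \<le> N then Cons 4 ` G_lists 4 n (N - 4) else {}) \<union> G_lists 4 (Suc n) N"
proof -
  have eq: "G_chain 3 ys \<longleftrightarrow> G_chain 2 ys" for ys
    by (cases ys) (simp_all add: G_step_2_3)
  have *: "G_chain 0 (x # ys) \<longleftrightarrow> x = 3 \<and> G_chain 2 ys \<or> x = 4 \<and> G_chain 4 ys \<or> G_chain 4 (x # ys)" for x ys
    unfolding G_chain.simps G_step_0[of x] using eq by auto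
  have "xs \<in> G_lists 0 (Suc n) N \<longleftrightarrow> xs \<in> (if 3 \<le> N then Cons 3 ` G_lists 2 n (N - 3) else {})
    \<union> (if 4 \<le> N then Cons 4 ` G_lists 4 n (N - 4) else {}) \<union> G_lists 4 (Suc n) N" for xs
  proof (cases xs)
    case (Cons x ys)
    have mem: "x # ys \<in> (if c \<le> N then Cons c ` G_lists p n (N - c) else {})
        \<longleftrightarrow> x = c \<and> G_chain p ys \<and> length ys = n \<and> c + sum_list ys = N" for c p
      by (auto simp: G_lists_def)
    show ?thesis
      unfolding Cons Un_iff mem by (auto simp: G_lists_def * simp del: G_chain.simps)
  qed (auto simp: G_lists_def)
  then show ?thesis by blast
qed

lemma G_gf_0_Suc:
  "G_gf 0 (Suc n) = fps_X ^ 3 * G_gf 2 n + fps_X ^ 4 * G_gf 4 n + G_gf 4 (Suc n)"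
proof -
  have "card (G_lists 0 (Suc n) N) = (if 3 \<le> N then card (G_lists 2 n (N - 3)) else 0)
      + (if 4 \<le> N then card (G_lists 4 n (N - 4)) else 0) + card (G_lists 4 (Suc n) N)" for N
  proof -
    let ?A = "if 3 \<le> N then Cons 3 ` G_lists 2 n (N - 3) else {}"
    let ?B = "if 4 \<le> N then Cons 4 ` G_lists 4 n (N - 4) else {}"
    have hd: "4 < hd xs" if "xs \<in> G_lists 4 (Suc n) N" for xs
      using that by (cases xs) (auto simp: G_lists_def dest: G_step_less)
    have A: "hd xs = 3" if "xs \<in> ?A" for xs
      using that by (auto split: if_splits)
    have B: "hd xs = 4" if "xs \<in> ?B" for xs
      using that by (auto split: if_splits)
    have disj: "?A \<inter> ?B = {}" "(?A \<union> ?B) \<inter> G_lists 4 (Suc n) N = {}"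
      using hd A B by fastforce+
    have "card (G_lists 0 (Suc n) N) = card ?A + card ?B + card (G_lists 4 (Suc n) N)"
      unfolding G_lists_0_Suc
      by (subst card_Un_disjoint[OF _ _ disj(2)], simp_all only: card_Un_disjoint[OF _ _ disj(1)] finite_Un)
        (simp_all add: finite_G_lists card_Un_disjoint[OF _ _ disj(1)])
    then show ?thesis
      by (simp add: card_image)
  qed
  then show ?thesis
    by (simp add: fps_eq_iff G_gf_def fps_X_power_mult_nth)
qed

text \<open>By the shift rule the recurrence reads G_(n+1) (1 - X^(4n+4)) = X^(2n+3) (1 + X^(2n+1))
  G_n, which the Slater summands satisfy as well.\<close>

lemma G_gf_eq_slater_term: "G_gf 0 n = slater_term n"
proof (induction n)
  case 0
  have "G_lists 0 0 N = (if N = 0 then {[]} else {})" for N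
    by (auto simp: G_lists_def)
  then show ?case
    by (simp add: fps_eq_iff G_gf_def slater_term_def)
next
  case (Suc n)
  let ?X = "fps_X :: rat fps"
  have shift: "G_gf 2 k = ?X ^ (2 * k) * G_gf 0 k" "G_gf 4 k = ?X ^ (4 * k) * G_gf 0 k" for k
  proof -
    show s2: "G_gf 2 k = ?X ^ (2 * k) * G_gf 0 k"
      using G_gf_shift[of 0 k] by (simp only: add_0)
    show "G_gf 4 k = ?X ^ (4 * k) * G_gf 0 k"
      using G_gf_shift[of 2 k] by (simp add: s2 mult.assoc[symmetric] flip: power_add)
  qed
  have "G_gf 0 (Suc n) * (1 - ?X ^ (4 * Suc n))
      = (?X ^ 3 * ?X ^ (2 * n) + ?X ^ 4 * ?X ^ (4 * n)) * slater_term n"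
    using G_gf_0_Suc[of n] unfolding shift Suc.IH by (simp add: algebra_simps)
  also have "?X ^ 3 * ?X ^ (2 * n) + ?X ^ 4 * ?X ^ (4 * n) = ?X ^ (2 * n + 3) * (1 + ?X ^ (2 * n + 1))"
  proof -
    have e: "4 + 4 * n = 2 * n + 3 + (2 * n + 1)" "3 + 2 * n = 2 * n + 3"
      by simp_all
    show ?thesis
      unfolding distrib_left mult_1_right power_add[symmetric] unfolding e by (rule refl)
  qed
  also have "\<dots> * slater_term n = slater_term (Suc n) * (1 - ?X ^ (4 * Suc n))"
  proof -
    have e: "Suc n * Suc n + 2 * Suc n = (n * n + 2 * n) + (2 * n + 3)"
      by simp
    have inv: "inverse (1 - ?X ^ (4 * Suc n)) * (1 - ?X ^ (4 * Suc n)) = 1"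
      by (rule inverse_mult_eq_1) simp
    have q: "qpoch (- ?X) (?X ^ 2) (Suc n) = qpoch (- ?X) (?X ^ 2) n * (1 + ?X ^ (2 * n + 1))"
      "qpoch (?X ^ 4) (?X ^ 4) (Suc n) = qpoch (?X ^ 4) (?X ^ 4) n * (1 - ?X ^ (4 * Suc n))"
      by (simp_all add: qpoch_Suc flip: power_mult power_add power_Suc)
    have "slater_term (Suc n) * (1 - ?X ^ (4 * Suc n)) = ?X ^ (2 * n + 3) * (1 + ?X ^ (2 * n + 1)) * slater_term n
        * (inverse (1 - ?X ^ (4 * Suc n)) * (1 - ?X ^ (4 * Suc n)))"
      unfolding slater_term_def e q fps_inverse_mult power_add[of _ "n * n + 2 * n"] by (simp only: mult_ac)
    then show ?thesis
      unfolding inv by simp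
  qed
  \<comment> \<open>The cancelled factor 1 - X^(4n+4) is nonzero because its constant coefficient is
    1.\<close>
  finally show ?case
    by (rule mult_right_cancel[THEN iffD1, rotated])
      (metis fps_X_power_nth fps_one_nth fps_sub_nth fps_zero_nth diff_zero mult_is_0 numeral_eq_iff old.nat.distinct(1) zero_neq_numeral zero_neq_one)
qed

text \<open>Here \<open>t\<close> stands for \<open>k + s(b; \<pi>)\<close>, where \<open>b\<close> is the head of the list.\<close>

fun G_residues :: "nat \<Rightarrow> nat list \<Rightarrow> bool" where
  "G_residues t [] \<longleftrightarrow> True"
| "G_residues t (x # xs) \<longleftrightarrow> x mod 4 = (2 * t + (if even x then 2 else 1)) mod 4
    \<and> G_residues (t + (if even x then 2 else 1)) xs"

section \<open>Chains and the partitions counted by G\<close>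

text \<open>Induction along the list: passing a part raises k by 1, and passing an even part also
  raises s by 1, so the hypothesis on \<open>p\<close> and \<open>t\<close> is inherited by the head
  and the new \<open>t\<close>.\<close>

lemma G_chain_iff_residues:
  assumes "p mod 4 = (2 * t + (if even p then 2 else 3)) mod 4"
  shows "G_chain p xs \<longleftrightarrow> sorted_wrt (<) (p # xs) \<and> G_residues t xs"
  using assms
proof (induction xs arbitrary: p t)
  case (Cons x xs)
  let ?t = "t + (if even x then 2 else 1)"
  have step: "G_step p x \<longleftrightarrow> p < x \<and> x mod 4 = (2 * t + (if even x then 2 else 1)) mod 4"
    using Cons.prems by (rule G_step_iff_residue)
  have res: "x mod 4 = (2 * ?t + (if even x then 2 else 3)) mod 4"
    if "x mod 4 = (2 * t + (if even x then 2 else 1)) mod 4"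
  proof -
    have "(a + 4) mod 4 = a mod 4" for a :: nat by simp
    from this[of "2 * t + 1"] this[of "2 * t + 2"] show ?thesis
      using that by (simp del: mod_add_self2)
  qed
  have sorted: "sorted_wrt (<) (p # x # xs) \<longleftrightarrow> p < x \<and> sorted_wrt (<) (x # xs)"
    by auto
  show ?case
    unfolding G_chain.simps G_residues.simps step sorted using Cons.IH[of x ?t] res by blast
qed simp

lemma G_residues_nth:
  "G_residues t xs \<longleftrightarrow> (\<forall>i<length xs. xs ! i mod 4
    = (2 * (t + i + length (filter even (take i xs))) + (if even (xs ! i) then 2 else 1)) mod 4)"
proof (induction xs arbitrary: t)
  case (Cons x xs)
  show ?case
    by (simp add: Cons.IH All_less_Suc2 add_ac)
qed simp

lemma G_chain_gap:
  "G_chain p xs \<Longrightarrow> Suc i < length xs \<Longrightarrow> \<not> [xs ! Suc i - xs ! i = 1] (mod 4)"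
proof (induction xs arbitrary: p i)
  case (Cons x xs)
  show ?case
  proof (cases i)
    case 0
    obtain y ys where xs: "xs = y # ys"
      using Cons.prems(2) by (cases xs) auto
    show ?thesis
      using Cons.prems G_step_gap by (simp add: 0 xs cong_def)
  qed (use Cons in auto)
qed simp

lemma even_parts_below_nth:
  assumes "sorted_wrt (<) xs" "i < length xs"
  shows "even_parts_below (xs ! i) (mset xs) = length (filter even (take i xs))"
proof -
  have "filter (\<lambda>a. even a \<and> a < xs ! i) xs
      = filter (\<lambda>a. even a \<and> a < xs ! i) (take i xs) @ filter (\<lambda>a. even a \<and> a < xs ! i) (drop i xs)"
    by (simp flip: filter_append)
  also have "filter (\<lambda>a. even a \<and> a < xs ! i) (take i xs) = filter even (take i xs)"
    using assms by (intro filter_cong) (auto simp: in_set_conv_nth sorted_wrt_iff_nth_less)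
  also have "filter (\<lambda>a. even a \<and> a < xs ! i) (drop i xs) = []"
  proof -
    have "xs ! i \<le> a" if "a \<in> set (drop i xs)" for a
    proof -
      obtain j where j: "a = xs ! (i + j)" "i + j < length xs"
        using \<open>a \<in> set (drop i xs)\<close> assms(2) by (auto simp: in_set_conv_nth)
      then show ?thesis
        using assms(1) by (cases "j = 0") (auto simp: sorted_wrt_iff_nth_less less_imp_le)
    qed
    then show ?thesis
      by (force simp: filter_empty_conv)
  qed
  finally show ?thesis
    by (simp add: even_parts_below_def flip: mset_filter)
qed

lemma mset_in_G_partitions_iff:
  assumes "sorted xs"
  shows "mset xs \<in> G_partitions N \<longleftrightarrow> G_chain 0 xs \<and> sum_list xs = N"
proof -
  have kth: "kth_smallest (mset xs) k = xs ! (k - 1)" for k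
    using assms by (simp add: kth_smallest_def sorted_list_of_multiset_mset sorted_sort_id)
  \<comment> \<open>The parts are indexed from 1 in the definition of G and from 0 in the
    list.\<close>
  have range: "(\<forall>k\<in>{1..n}. Q k) \<longleftrightarrow> (\<forall>i<n. Q (Suc i))" for Q n
    by (auto simp: Suc_le_eq) (metis Suc_pred' le_imp_less_Suc less_eq_Suc_le Suc_le_eq Suc_less_eq)
  have sorted: "(\<forall>b\<in>set xs. 0 < b) \<and> distinct_parts (mset xs) \<longleftrightarrow> sorted_wrt (<) (0 # xs)"
  proof -
    have "distinct_parts (mset xs) \<longleftrightarrow> distinct xs"
      by (auto simp: distinct_parts_def distinct_count_atmost_1 count_eq_zero_iff)
    then show ?thesis
      using assms by (simp add: strict_sorted_iff)
  qed
  have residues: "(\<forall>k\<in>{1..size (mset xs)}. let b = kth_smallest (mset xs) k in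
        (odd b \<longrightarrow> [b = 1 + 2 * k + 2 * even_parts_below b (mset xs)] (mod 4)) \<and>
        (even b \<longrightarrow> [b = 2 + 2 * k + 2 * even_parts_below b (mset xs)] (mod 4)))
      \<longleftrightarrow> G_residues 1 xs" if "sorted_wrt (<) xs"
    unfolding kth size_mset range G_residues_nth
    by (intro all_cong) (auto simp: even_parts_below_nth[OF that] cong_def Let_def algebra_simps)
  have gaps: "\<forall>k\<in>{1..<size (mset xs)}.
      \<not> [kth_smallest (mset xs) (k + 1) - kth_smallest (mset xs) k = 1] (mod 4)" if "G_chain 0 xs"
  proof
    fix k assume "k \<in> {1..<size (mset xs)}"
    then show "\<not> [kth_smallest (mset xs) (k + 1) - kth_smallest (mset xs) k = 1] (mod 4)"
      unfolding kth using G_chain_gap[OF that, of "k - 1"] by simp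
  qed
  have parts: "mset xs \<in> partitions_of N \<longleftrightarrow> (\<forall>b\<in>set xs. 0 < b) \<and> sum_list xs = N"
    by (simp add: partitions_of_def sum_mset_sum_list)
  \<comment> \<open>The smallest part has k = 1 and s = 0, so \<open>t\<close> starts at 1; the
    fictitious part 0 fits because 0 is congruent to 2 + 2 modulo 4.\<close>
  have chain: "G_chain 0 xs \<longleftrightarrow> sorted_wrt (<) (0 # xs) \<and> G_residues 1 xs"
    by (rule G_chain_iff_residues) simp
  have tail: "sorted_wrt (<) (0 # xs) \<Longrightarrow> sorted_wrt (<) xs"
    by simp
  show ?thesis
    unfolding G_partitions_def mem_Collect_eq parts using sorted residues gaps chain tail by blast
qed

text \<open>The parts are positive, so there are at most N \<le> m of them, and sorting identifies
  the partitions with a disjoint union of \<open>G_lists\<close> over the lengths up to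
  \<open>m\<close>.\<close>

lemma count_G_eq_coeff:
  assumes "N \<le> m"
  shows "of_nat (count_G N) = fps_nth (\<Sum>n\<le>m. slater_term n) N"
proof -
  have sorted: "sorted xs" if "G_chain 0 xs" for xs
    using that G_chain_iff_residues[of 0 1 xs] by (simp add: strict_sorted_imp_sorted)
  have "bij_betw mset (\<Union>n\<le>m. G_lists 0 n N) (G_partitions N)"
  proof (rule bij_betw_byWitness[where f' = sorted_list_of_multiset])
    have len: "length xs \<le> m" if "G_chain 0 xs" "sum_list xs = N" for xs
    proof -
      have "\<forall>x\<in>set xs. 0 < x"
        using G_chain_less[OF that(1)] by blast
      then have "length xs \<le> sum_list xs"
        by (induction xs) auto
      then show ?thesis
        using that assms by simp
    qed
    show "sorted_list_of_multiset ` G_partitions N \<subseteq> (\<Union>n\<le>m. G_lists 0 n N)"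
    proof safe
      fix p assume "p \<in> G_partitions N"
      then have "G_chain 0 (sorted_list_of_multiset p) \<and> sum_list (sorted_list_of_multiset p) = N"
        using mset_in_G_partitions_iff[of "sorted_list_of_multiset p" N] by simp
      then show "sorted_list_of_multiset p \<in> (\<Union>n\<le>m. G_lists 0 n N)"
        using len by (simp add: G_lists_def)
    qed
  qed (use sorted mset_in_G_partitions_iff in \<open>auto simp: G_lists_def sorted_list_of_multiset_mset sorted_sort_id\<close>)
  then have "count_G N = card (\<Union>n\<le>m. G_lists 0 n N)"
    by (simp add: count_G_def bij_betw_same_card)
  also have "\<dots> = (\<Sum>n\<le>m. card (G_lists 0 n N))"
    by (intro card_UN_disjoint) (auto simp: finite_G_lists, auto simp: G_lists_def)
  finally show ?thesis
    by (simp add: fps_sum_nth G_gf_def flip: G_gf_eq_slater_term)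
qed

theorem theorem5:
  fixes N :: nat
  shows "count_G N = count_P N"
proof -
  \<comment> \<open>Agreement modulo X^m covers only indices below m, hence m =
    \<open>Suc N\<close>.\<close>
  have "of_nat (count_G N) = (of_nat (count_P N) :: rat)"
    using slater_sum_eq_product[of "Suc N"] count_P_eq_coeff[of N "Suc N"] count_G_eq_coeff[of N "Suc N"]
    by (simp add: fps_agree_def)
  then show ?thesis
    by simp
qed

end
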